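(* Let $\alpha\in(0,1/2]$ and consider the model D-EX-t$(\zeta_n)$ described in the context with $\lim_{n\to\infty}\zeta_n=1$. The set of largest crossing points is $C_1=\{0\}\cup(t_2,\alpha/2)$ and \[ \operatorname{EER}_\infty(1)=\frac{t_2\,F_{\chi_\nu}(\sqrt\nu\,s(t_2\mid1))}{\alpha}+\int_{t_2/\alpha}^{1}F_{\chi_\nu}\big(\sqrt\nu\,s(\alpha t\mid1)\big)dt,\qquad \operatorname{FDR}_\infty(1)=F_{\chi_\nu}\big(\sqrt\nu\,s(t_2\mid1)\big). \]
   Context: Model D-EX-t$(\zeta_n)$: fix $\nu>0$. Let $X_1,\dots,X_n$ be independent with $X_i\sim N(\vartheta_i,1)$ and $S>0$ with $\nu S^2\sim\chi^2_\nu$ independent of the $X_i$; $F_{\chi_\nu}$ is the c.d.f. of $\sqrt\nu S$ (with $F_{\chi_\nu}(x)=0$ for $x\le0$). $\Phi$ is the standard normal c.d.f., $F_{t_\nu}$ the central $t_\nu$ c.d.f. For $H_i:\vartheta_i=0$ vs $K_i:\vartheta_i>0$, $p_i=1-F_{t_\nu}(X_i/S)$; $\vartheta_i=\infty$ is allowed and gives $p_i=0$ a.s. For each $n$, exactly $n_0$ hypotheses are true, $\zeta_n=n_0/n$, the rest have $\vartheta_i=\infty$. LSU at level $\alpha$ rejects all $H_i$ with $p_i\le m\alpha/n$, $m=\max\{i:p_{i:n}\le i\alpha/n\}$. $V_n$ = number of rejected true hypotheses, $R_n$ = number of rejections, $\operatorname{EER}_\infty(1)=\lim_n\mathbb E[V_n/n]$,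 $\operatorname{FDR}_\infty(1)=\lim_n\mathbb E[V_n/(R_n\vee1)]$. Given $S=s$, $F_\infty(t\mid s)=1-\Phi(sF_{t_\nu}^{-1}(1-t))$; $F_\infty(t\mid s)=t/\alpha$ iff $s=s(t\mid1):=\Phi^{-1}(1-t/\alpha)/F_{t_\nu}^{-1}(1-t)$. $t(s\mid1)=\sup\{t\in[0,\alpha]:F_\infty(t\mid s)=t/\alpha\}$, called a largest crossing point (LCP) when $F_\infty(\cdot\mid s)$ lies above $t/\alpha$ just to its left and below just to its right; $C_1$ is the set of LCPs. $t_2$ denotes the (existing) tangent point: there is $s^*>0$ such that with $u=F_{t_\nu}^{-1}(1-t_2)$, $\alpha\Phi(-s^*u)=F_{t_\nu}(-u)$ and $s^*\alpha\varphi(s^*u)=f_{t_\nu}(u)$, i.e. $F_\infty(\cdot\mid s^* )$ touches the line $t\mapsto t/\alpha$ at $t_2$; here $\varphi$ is the standard normal density and $f_{t_\nu}$ the $t_\nu$ density. *)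

theory Defs
  imports "HOL-Probability.Probability"
begin

definition Phi :: "real \<Rightarrow> real" where
  "Phi x = (LINT y:{..x}|lborel. std_normal_density y)"

definition Phi_inv :: "real \<Rightarrow> real" where
  "Phi_inv p = (THE x. Phi x = p)"

definition t_density :: "real \<Rightarrow> real \<Rightarrow> real" where
  "t_density \<nu> x = Gamma ((\<nu> + 1) / 2) / (sqrt (\<nu> * pi) * Gamma (\<nu> / 2))
       * (1 + x\<^sup>2 / \<nu>) powr (- (\<nu> + 1) / 2)"

definition F_t :: "real \<Rightarrow> real \<Rightarrow> real" where
  "F_t \<nu> x = (LINT y:{..x}|lborel. t_density \<nu> y)"

definition F_t_inv :: "real \<Rightarrow> real \<Rightarrow> real" where
  "F_t_inv \<nu> p = (THE x. F_t \<nu> x = p)"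

definition chisq_density :: "real \<Rightarrow> real \<Rightarrow> real" where
  "chisq_density \<nu> x = (if 0 < x then x powr (\<nu> / 2 - 1) * exp (- x / 2)
       / (2 powr (\<nu> / 2) * Gamma (\<nu> / 2)) else 0)"

text \<open>F_chi nu: c.d.f. of sqrt(nu) S where nu S^2 is chi-square(nu), i.e.
  P(sqrt nu S <= x) = P(nu S^2 <= x^2) for x > 0, and 0 for x <= 0.\<close>
definition F_chi :: "real \<Rightarrow> real \<Rightarrow> real" where
  "F_chi \<nu> x = (if x \<le> 0 then 0 else (LINT y:{0..x\<^sup>2}|lborel. chisq_density \<nu> y))"

definition F_inf :: "real \<Rightarrow> real \<Rightarrow> real \<Rightarrow> real" where
  "F_inf \<nu> s t = (if t \<le> 0 then 0 else if 1 \<le> t then 1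
       else 1 - Phi (s * F_t_inv \<nu> (1 - t)))"

definition s_cross :: "real \<Rightarrow> real \<Rightarrow> real \<Rightarrow> real" where
  "s_cross \<nu> \<alpha> t = Phi_inv (1 - t / \<alpha>) / F_t_inv \<nu> (1 - t)"

definition t_cross :: "real \<Rightarrow> real \<Rightarrow> real \<Rightarrow> real" where
  "t_cross \<nu> \<alpha> s = Sup {t \<in> {0..\<alpha>}. F_inf \<nu> s t = t / \<alpha>}"

text \<open>t is a largest crossing point (LCP): t = t(s|1) for some s > 0, F_infinity(.|s) lies
  strictly above the line t/alpha just to the left of t (vacuous at t = 0, the left end of
  the domain [0,alpha]) and strictly below it just to the right.\<close>
definition is_LCP :: "real \<Rightarrow> real \<Rightarrow> real \<Rightarrow> bool" where
  "is_LCP \<nu> \<alpha> t \<longleftrightarrow> (\<exists>s>0. t = t_cross \<nu> \<alpha> s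
      \<and> (t = 0 \<or> (\<exists>\<epsilon>>0. \<forall>x\<in>{t - \<epsilon><..<t}. F_inf \<nu> s x > x / \<alpha>))
      \<and> (\<exists>\<epsilon>>0. \<forall>x\<in>{t<..<t + \<epsilon>}. F_inf \<nu> s x < x / \<alpha>))"

definition LCP_set :: "real \<Rightarrow> real \<Rightarrow> real set" where
  "LCP_set \<nu> \<alpha> = {t. is_LCP \<nu> \<alpha> t}"

definition is_tangent_point :: "real \<Rightarrow> real \<Rightarrow> real \<Rightarrow> bool" where
  "is_tangent_point \<nu> \<alpha> t2 \<longleftrightarrow> 0 < t2 \<and> t2 < 1 \<and>
     (\<exists>s>0. let u = F_t_inv \<nu> (1 - t2) in
        \<alpha> * Phi (- s * u) = F_t \<nu> (- u) \<and> s * \<alpha> * std_normal_density (s * u) = t_density \<nu> u)"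

text \<open>i-th order statistic p_{i:n} (1-based) of p_0,...,p_{n-1}.\<close>
definition ord_stat :: "(nat \<Rightarrow> real) \<Rightarrow> nat \<Rightarrow> nat \<Rightarrow> real" where
  "ord_stat p n i = sort (map p [0..<n]) ! (i - 1)"

definition lsu_m :: "real \<Rightarrow> nat \<Rightarrow> (nat \<Rightarrow> real) \<Rightarrow> nat" where
  "lsu_m \<alpha> n p = (let A = {i \<in> {1..n}. ord_stat p n i \<le> real i * \<alpha> / real n}
      in if A = {} then 0 else Max A)"

definition lsu_rej :: "real \<Rightarrow> nat \<Rightarrow> (nat \<Rightarrow> real) \<Rightarrow> nat set" where
  "lsu_rej \<alpha> n p = (if lsu_m \<alpha> n p = 0 then {}
      else {i \<in> {..<n}. p i \<le> real (lsu_m \<alpha> n p) * \<alpha> / real n})"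

text \<open>p-values: p_i = 1 - F_t(X_i / S) for true hypotheses (i in T); for false hypotheses
  theta_i = infinity, so p_i = 0.\<close>
definition pval :: "real \<Rightarrow> nat set \<Rightarrow> (nat \<Rightarrow> 'a \<Rightarrow> real) \<Rightarrow> ('a \<Rightarrow> real) \<Rightarrow> 'a \<Rightarrow> nat \<Rightarrow> real" where
  "pval \<nu> T X S \<omega> i = (if i \<in> T then 1 - F_t \<nu> (X i \<omega> / S \<omega>) else 0)"

definition R_count :: "real \<Rightarrow> real \<Rightarrow> nat \<Rightarrow> nat set \<Rightarrow> (nat \<Rightarrow> 'a \<Rightarrow> real) \<Rightarrow> ('a \<Rightarrow> real) \<Rightarrow> 'a \<Rightarrow> nat" where
  "R_count \<nu> \<alpha> n T X S \<omega> = card (lsu_rej \<alpha> n (pval \<nu> T X S \<omega>))"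

definition V_count :: "real \<Rightarrow> real \<Rightarrow> nat \<Rightarrow> nat set \<Rightarrow> (nat \<Rightarrow> 'a \<Rightarrow> real) \<Rightarrow> ('a \<Rightarrow> real) \<Rightarrow> 'a \<Rightarrow> nat" where
  "V_count \<nu> \<alpha> n T X S \<omega> = card (lsu_rej \<alpha> n (pval \<nu> T X S \<omega>) \<inter> T)"

end

theory Submission
  imports Defs "HOL-Real_Asymp.Real_Asymp"
begin

text \<open>
  In the coordinate \<open>u = F_t_inv (1 - t)\<close> the crossing equation at \<open>t\<close> reads \<open>gap s u = 0\<close> with
  \<open>gap s u = \<alpha> Phi (- s u) - F_t (- u)\<close>. The log-ratio of the two densities in the derivative of
  \<open>gap s\<close> is convex in \<open>u\<^sup>2\<close>, so \<open>gap s\<close> increases, decreases and increases again, the last time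
  to its limit \<open>0\<close> from below. Hence a tangency can only occur at the local maximum, the
  tangent point is unique, and \<open>s_cross\<close> is decreasing between \<open>t2\<close> and \<open>\<alpha> / 2\<close>.

  Since \<open>p_i \<le> F_t (- u)\<close> iff \<open>X_i \<ge> S u\<close>, a Glivenko--Cantelli bound for the normal variables
  \<open>X_i\<close> alone controls the empirical distribution of the p-values for all values of \<open>S\<close> at once, and
  no conditioning on \<open>S\<close> is needed. It gives \<open>P (R_n / n \<ge> x) \<longlonglongrightarrow> P (S < threshold x)\<close> for each
  \<open>x\<close>; integrating over \<open>x\<close> yields EER. For FDR, \<open>V_n / R_n\<close> is close to \<open>1\<close> on \<open>S < s2\<close>, while on
  \<open>S > s2\<close> one has \<open>V_n / R_n \<le> \<alpha> / n * (\<Sum> 1 / p_i)\<close>, the sum being over the rejected true hypotheses,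
  whose p-values all tend to \<open>0\<close>; this vanishes in the limit because normal tails make \<open>1 / p_i\<close>
  integrable.
\<close>

section \<open>Symmetric densities and their distribution functions\<close>

text \<open>In the coordinate u no quantile function occurs, \<open>gap s u\<close> is decreasing in
  s for u > 0, and t \<le> \<alpha> \<le> 1/2 becomes u \<ge> 0. The step-up rule selects the
  largest crossing t, which is the first zero in u. For s below s2 this zero lies before u2; past s2
  there is none, and the crossing drops to 0. This jump is the plateau that produces the first term
  of the EER limit. At S = s2 itself the empirical distribution does not decide the outcome, which
  is harmless because S has no atoms.

  Each n has its own probability space, so the limits concern probabilities of events and never
  almost sure convergence; this calls for explicit deviation bounds. For S > s2 both R_n / n and V_n
  / n vanish in the limit, and a uniform law of large numbers says nothing about their ratio. The
  reciprocal bound replaces it: a p-value is bounded below by its value at a fixed s \<le> S, and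
  the t tail is only polynomially small where the normal density decays like a Gaussian.\<close>

locale symmetric_density =
  fixes f F :: "real \<Rightarrow> real"
  assumes cont: "\<And>x. isCont f x"
    and pos: "\<And>x. 0 < f x"
    and even: "\<And>x. f (- x) = f x"
    and total: "(\<integral>\<^sup>+x. ennreal (f x) \<partial>lborel) = 1"
    and F_def: "\<And>x. F x = (LINT y:{..x}|lborel. f y)"
begin

lemma borel [measurable]: "f \<in> borel_measurable borel"
  by (intro borel_measurable_continuous_onI continuous_at_imp_continuous_on) (auto simp: cont)

text \<open>The density as a probability measure, so that complements and the limits of a
  distribution function at infinity come from general measure theory.\<close>

definition D :: "real measure" where "D = density lborel (\<lambda>x. ennreal (f x))"

lemma prob_space_D: "prob_space D"
  by standard (simp add: D_def emeasure_density total)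

lemma real_distribution_D: "real_distribution D"
  using prob_space_D by (simp add: real_distribution_def real_distribution_axioms_def D_def)

lemma sets_D [measurable_cong, simp]: "sets D = sets borel"
  by (simp add: D_def)

lemma integrable: "integrable lborel f"
  by (rule integrableI_nonneg) (auto simp: total less_imp_le[OF pos])

lemma set_integrable: "A \<in> sets borel \<Longrightarrow> set_integrable lborel A f"
  unfolding set_integrable_def by (rule integrable_mult_indicator) (auto intro: integrable)

lemma measure_D: "A \<in> sets borel \<Longrightarrow> measure D A = (LINT y:A|lborel. f y)"
proof -
  assume A: "A \<in> sets borel"
  have "integrable lborel (\<lambda>x. f x * indicator A x)"
    using integrable_mult_indicator[OF _ integrable, of A] A by (simp add: mult.commute)
  then have "emeasure D A = ennreal (\<integral>x. f x * indicator A x \<partial>lborel)"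
    using A by (subst nn_integral_eq_integral[symmetric])
      (auto simp: D_def emeasure_density less_imp_le[OF pos] ennreal_mult' ennreal_indicator)
  then show ?thesis
    by (simp add: measure_def set_lebesgue_integral_def mult.commute
        integral_nonneg_AE less_imp_le[OF pos])
qed

lemma F_cdf: "F x = measure D {..x}"
  by (simp add: F_def measure_D)

text \<open>Bridge from the Lebesgue integral that defines F to the gauge integral over a compact
  interval, for which the fundamental theorem of calculus is available. Half-open and closed
  intervals differ by a null set.\<close>

lemma F_diff: "a \<le> b \<Longrightarrow> F b - F a = integral {a..b} f"
proof -
  assume ab: "a \<le> b"
  interpret prob_space D by (rule prob_space_D)
  have "{..b} = {..a} \<union> {a<..b}" using ab by auto
  then have "F b = F a + measure D {a<..b}"
    unfolding F_cdf by (subst finite_measure_Union[symmetric]) auto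
  also have "measure D {a<..b} = (LINT y:{a<..b}|lborel. f y)" by (simp add: measure_D)
  also have "\<dots> = (LINT y:{a..b}|lborel. f y)"
  proof (rule set_integral_cong_set)
    show "AE x in lborel. (x \<in> {a..b}) = (x \<in> {a<..b})"
      using AE_lborel_singleton[of a] by eventually_elim auto
  qed (auto simp: set_borel_measurable_def)
  finally show ?thesis
    using set_borel_integral_eq_integral(2)[OF set_integrable, of "{a..b}"] by simp
qed

lemma DERIV_F: "(F has_real_derivative f x) (at x)"
proof -
  have "((\<lambda>y. F (x - 1) + integral {x - 1..y} f) has_real_derivative f x) (at x within {x - 1..x + 1})"
    by (auto intro!: derivative_eq_intros integral_has_real_derivative
        continuous_at_imp_continuous_on simp: cont)
  then have "(F has_real_derivative f x) (at x within {x - 1..x + 1})"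
    by (rule has_field_derivative_transform_within[OF _ zero_less_one]) (auto simp: F_diff[symmetric])
  then show ?thesis by (simp add: at_within_Icc_at)
qed

lemma isCont_F: "isCont F x"
  using DERIV_F by (rule DERIV_isCont)

lemma F_less_iff [simp]: "F x < F y \<longleftrightarrow> x < y"
proof -
  have "F x < F y" if "x < y" for x y
    by (rule DERIV_pos_imp_increasing[OF that]) (rule exI, rule conjI, rule DERIV_F, rule pos)
  from this[of x y] this[of y x] show ?thesis
    by (cases x y rule: linorder_cases) auto
qed

lemma F_le_iff [simp]: "F x \<le> F y \<longleftrightarrow> x \<le> y"
  by (simp flip: not_less)

lemma F_eq_iff [simp]: "F x = F y \<longleftrightarrow> x = y"
  by (auto simp: order_eq_iff)

lemma mono_F: "mono F"
  by (simp add: mono_def)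

lemma borel_measurable_F [measurable]: "F \<in> borel_measurable borel"
  using mono_F by (rule borel_measurable_mono)

lemma F_minus_eq: "F (- x) = (LINT y:{x..}|lborel. f y)"
proof -
  have "F (- x) = (\<integral>y. indicator {..- x} (- y) * f (- y) \<partial>lborel)"
    unfolding F_def set_lebesgue_integral_def
    by (subst lborel_integral_real_affine[where c = "-1" and t = 0]) auto
  also have "\<dots> = (LINT y:{x..}|lborel. f y)"
    by (auto simp: set_lebesgue_integral_def even intro!: Bochner_Integration.integral_cong
        split: split_indicator)
  finally show ?thesis .
qed

lemma F_minus: "F (- x) = 1 - F x"
proof -
  interpret prob_space D by (rule prob_space_D)
  have "F (- x) = (LINT y:{x<..}|lborel. f y)"
    unfolding F_minus_eq
  proof (rule set_integral_cong_set)
    show "AE y in lborel. (y \<in> {x<..}) = (y \<in> {x..})"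
      using AE_lborel_singleton[of x] by eventually_elim auto
  qed (auto simp: set_borel_measurable_def)
  also have "\<dots> = measure D (space D - {..x})"
    by (subst measure_D[symmetric]) (auto simp: D_def intro!: arg_cong2[where f = measure])
  also have "\<dots> = 1 - F x"
    by (subst prob_compl) (auto simp: F_cdf)
  finally show ?thesis .
qed

lemma F_0: "F 0 = 1 / 2"
  using F_minus[of 0] by simp

lemma F_at_bot: "(F \<longlongrightarrow> 0) at_bot"
proof -
  interpret real_distribution D by (rule real_distribution_D)
  have "F = cdf D" by (auto simp: F_cdf cdf_def)
  then show ?thesis using cdf_lim_at_bot by simp
qed

lemma F_at_top: "(F \<longlongrightarrow> 1) at_top"
proof -
  interpret real_distribution D by (rule real_distribution_D)
  have "F = cdf D" by (auto simp: F_cdf cdf_def)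
  then show ?thesis using cdf_lim_at_top_prob by simp
qed

lemma F_pos: "0 < F x"
proof -
  have "0 \<le> F (x - 1)" by (simp add: F_cdf)
  also have "\<dots> < F x" by simp
  finally show ?thesis .
qed

lemma F_less_1: "F x < 1"
  using F_pos[of "- x"] F_minus[of x] by simp

lemma F_surj:
  assumes "0 < p" "p < 1"
  obtains x where "F x = p"
proof -
  obtain a where a: "F a < p"
    using order_tendstoD(2)[OF F_at_bot \<open>0 < p\<close>] by (metis eventually_at_bot_linorder order_refl)
  obtain b where b: "p < F b"
    using order_tendstoD(1)[OF F_at_top \<open>p < 1\<close>] by (metis eventually_at_top_linorder order_refl)
  show thesis
  proof -
    have "F a < F b" using a b by linarith
    then have "a \<le> b" by simp
    moreover have "continuous_on {a..b} F"
      by (intro continuous_at_imp_continuous_on ballI isCont_F)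
    ultimately obtain x where "F x = p"
      using IVT'[of F a p b] a b by fastforce
    then show thesis by (rule that)
  qed
qed

text \<open>Together with \<open>F_the\<close> this justifies quantile functions given by a definite
  description: strict monotonicity yields uniqueness, the intermediate value theorem
  existence.\<close>

lemma the_F: "(THE x. F x = F y) = y"
  by (rule the_equality) auto

lemma F_the:
  assumes "0 < p" "p < 1"
  shows "F (THE x. F x = p) = p"
  using F_surj[OF assms] the_F by metis

end

interpretation normal: symmetric_density std_normal_density Phi
proof
  show "(\<integral>\<^sup>+x. ennreal (std_normal_density x) \<partial>lborel) = 1"
    by (subst nn_integral_eq_integral) auto
  show "isCont std_normal_density x" for x
    unfolding normal_density_def by (intro continuous_intros) auto
  show "0 < std_normal_density x" for x
    by (simp add: normal_density_pos)
  show "std_normal_density (- x) = std_normal_density x" for x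
    by (simp add: normal_density_def)
  show "Phi x = (LINT y:{..x}|lborel. std_normal_density y)" for x
    by (rule Phi_def)
qed

section \<open>Total mass of the t density\<close>

lemma nn_integral_Gamma:
  fixes a c :: real
  assumes "0 < a" "0 < c"
  shows "(\<integral>\<^sup>+y. ennreal (indicator {0..} y * (y powr (a - 1) * exp (- (c * y)))) \<partial>lborel)
    = ennreal (Gamma a / c powr a)"
proof -
  let ?g = "\<lambda>c y::real. indicator {0..} y * (y powr (a - 1) * exp (- (c * y)))"
  have "ennreal (Gamma a)
      = (\<integral>\<^sup>+y. ennreal (indicator {0..} y * (y powr (a - 1) / exp y)) \<partial>lborel)"
    by (rule nn_integral_has_integral_lebesgue[OF _ Gamma_integral_real[OF \<open>0 < a\<close>], symmetric]) auto
  also have "\<dots> = (\<integral>\<^sup>+y. ennreal (?g 1 y) \<partial>lborel)"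
    by (intro nn_integral_cong) (simp add: exp_minus field_simps)
  also have "\<dots> = ennreal c * (\<integral>\<^sup>+y. ennreal (?g 1 (c * y)) \<partial>lborel)"
    using assms by (subst nn_integral_real_affine[where c = c and t = 0]) auto
  also have "(\<integral>\<^sup>+y. ennreal (?g 1 (c * y)) \<partial>lborel)
      = (\<integral>\<^sup>+y. ennreal (c powr (a - 1)) * ennreal (?g c y) \<partial>lborel)"
    using assms by (intro nn_integral_cong)
      (auto simp: powr_mult ennreal_mult'[symmetric] zero_le_mult_iff split: split_indicator)
  also have "\<dots> = ennreal (c powr (a - 1)) * (\<integral>\<^sup>+y. ennreal (?g c y) \<partial>lborel)"
    by (rule nn_integral_cmult) simp
  finally have *: "ennreal (Gamma a)
      = ennreal c * (ennreal (c powr (a - 1)) * (\<integral>\<^sup>+y. ennreal (?g c y) \<partial>lborel))" .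
  define I where "I = (\<integral>\<^sup>+y. ennreal (?g c y) \<partial>lborel)"
  have "ennreal (Gamma a / c powr a) = ennreal (1 / c powr a) * ennreal (Gamma a)"
    by (simp add: ennreal_mult'[symmetric])
  also have "\<dots> = ennreal (1 / c powr a * c * c powr (a - 1)) * I"
    using assms unfolding * I_def[symmetric]
    by (simp add: mult.assoc[symmetric] ennreal_mult'[symmetric])
  also have "1 / c powr a * c * c powr (a - 1) = 1"
    using assms by (simp add: powr_diff)
  finally show ?thesis by (simp add: I_def)
qed

text \<open>The integrand is a multiple of the centred normal density with variance 1 / (2
  c).\<close>

lemma nn_integral_gaussian:
  assumes "0 < (c::real)"
  shows "(\<integral>\<^sup>+x. ennreal (exp (- (c * x\<^sup>2))) \<partial>lborel) = ennreal (sqrt (pi / c))"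
proof -
  define \<sigma> where "\<sigma> = sqrt (1 / (2 * c))"
  have \<sigma>: "0 < \<sigma>" "\<sigma>\<^sup>2 = 1 / (2 * c)"
    using assms by (auto simp: \<sigma>_def)
  have eq: "exp (- (c * x\<^sup>2)) = sqrt (pi / c) * normal_density 0 \<sigma> x" for x
    using assms by (simp add: normal_density_def \<sigma>)
  have "(\<integral>\<^sup>+x. ennreal (normal_density 0 \<sigma> x) \<partial>lborel) = 1"
    using \<sigma> by (subst nn_integral_eq_integral) auto
  then show ?thesis
    using assms unfolding eq by (simp add: ennreal_mult' nn_integral_cmult)
qed

text \<open>The t density is a Gamma mixture of centred normal densities, so Tonelli computes its mass.\<close>

lemma nn_integral_t_density:
  assumes "0 < \<nu>"
  shows "(\<integral>\<^sup>+x. ennreal (t_density \<nu> x) \<partial>lborel) = 1"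
proof -
  define a where "a = (\<nu> + 1) / 2"
  have a: "0 < a" "a - 1 = \<nu> / 2 - 1 + 1 / 2" using assms by (auto simp: a_def field_simps)
  let ?h = "\<lambda>x y::real. indicator {0..} y * (y powr (a - 1) * exp (- ((1 + x\<^sup>2 / \<nu>) * y)))"
  have pos: "0 < 1 + x\<^sup>2 / \<nu>" for x using assms by (simp add: add_pos_nonneg)
  have "(\<integral>\<^sup>+x. ennreal (Gamma a * (1 + x\<^sup>2 / \<nu>) powr (- a)) \<partial>lborel)
      = (\<integral>\<^sup>+x. (\<integral>\<^sup>+y. ennreal (?h x y) \<partial>lborel) \<partial>lborel)"
    by (rule nn_integral_cong) (simp only: nn_integral_Gamma[OF a(1) pos] powr_minus_divide times_divide_eq_right mult_1_right)
  also have "\<dots> = (\<integral>\<^sup>+y. (\<integral>\<^sup>+x. ennreal (?h x y) \<partial>lborel) \<partial>lborel)"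
    by (rule lborel_pair.Fubini'[symmetric]) simp
  also have "\<dots> = (\<integral>\<^sup>+y. ennreal (sqrt (\<nu> * pi)) *
      ennreal (indicator {0..} y * (y powr (\<nu> / 2 - 1) * exp (- (1 * y)))) \<partial>lborel)"
  proof (rule nn_integral_cong_AE)
    \<comment> \<open>Only y = 0 is exceptional: the Gaussian integral needs a positive rate y /
      \<nu>, while for y < 0 the indicator makes both sides vanish.\<close>
    show "AE y in lborel. (\<integral>\<^sup>+x. ennreal (?h x y) \<partial>lborel) = ennreal (sqrt (\<nu> * pi)) *
      ennreal (indicator {0..} y * (y powr (\<nu> / 2 - 1) * exp (- (1 * y))))"
      using AE_lborel_singleton[of 0]
    proof eventually_elim
      case (elim y)
      show ?case
      proof (cases "0 < y")
        case True
        have *: "ennreal (?h x y)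
            = ennreal (y powr (a - 1) * exp (- y)) * ennreal (exp (- (y / \<nu> * x\<^sup>2)))" for x
        proof -
          have "- ((1 + x\<^sup>2 / \<nu>) * y) = - y + - (y / \<nu> * x\<^sup>2)"
            by (simp add: algebra_simps)
          then have "exp (- ((1 + x\<^sup>2 / \<nu>) * y)) = exp (- y) * exp (- (y / \<nu> * x\<^sup>2))"
            by (simp only: exp_add)
          then have "?h x y = y powr (a - 1) * exp (- y) * exp (- (y / \<nu> * x\<^sup>2))"
            using True by simp
          then show ?thesis
            by (simp only:) (rule ennreal_mult', simp)
        qed
        have "(\<integral>\<^sup>+x. ennreal (?h x y) \<partial>lborel)
            = (\<integral>\<^sup>+x. ennreal (y powr (a - 1) * exp (- y)) *
                ennreal (exp (- (y / \<nu> * x\<^sup>2))) \<partial>lborel)"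
          by (rule nn_integral_cong) (rule *)
        also have "\<dots> = ennreal (y powr (a - 1) * exp (- y)) *
            (\<integral>\<^sup>+x. ennreal (exp (- (y / \<nu> * x\<^sup>2))) \<partial>lborel)"
          by (rule nn_integral_cmult) simp
        also have "\<dots> = ennreal (y powr (a - 1) * exp (- y)) * ennreal (sqrt (pi / (y / \<nu>)))"
          by (subst nn_integral_gaussian[OF divide_pos_pos[OF True assms]]) (rule refl)
        also have "\<dots> = ennreal (y powr (a - 1) * exp (- y) * sqrt (pi / (y / \<nu>)))"
          by (rule ennreal_mult'[symmetric]) simp
        also have "y powr (a - 1) * exp (- y) * sqrt (pi / (y / \<nu>))
            = sqrt (\<nu> * pi) * (y powr (\<nu> / 2 - 1) * exp (- y))"
        proof -
          have "sqrt (pi / (y / \<nu>)) = sqrt (\<nu> * pi / y)"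
            by (simp add: mult.commute)
          also have "\<dots> = sqrt (\<nu> * pi) / sqrt y"
            by (rule real_sqrt_divide)
          finally show ?thesis
            using True powr_half_sqrt[of y] powr_add[of y "\<nu> / 2 - 1" "1 / 2"] by (simp add: a(2))
        qed
        also have "ennreal \<dots> = ennreal (sqrt (\<nu> * pi)) *
            ennreal (indicator {0..} y * (y powr (\<nu> / 2 - 1) * exp (- (1 * y))))"
          using True assms by (subst ennreal_mult'[symmetric]) auto
        finally show ?thesis .
      next
        case False
        with elim have "indicator {0..} y = (0::real)" by simp
        then show ?thesis by (simp only: mult_zero_left) simp
      qed
    qed
  qed
  also have "\<dots> = ennreal (sqrt (\<nu> * pi)) * ennreal (Gamma (\<nu> / 2))"
  proof -
    have "(\<lambda>y. ennreal (indicator {0..} y * (y powr (\<nu> / 2 - 1) * exp (- (1 * y)))))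
        \<in> borel_measurable lborel" by measurable
    moreover have "0 < \<nu> / 2" using assms by simp
    ultimately show ?thesis
      by (simp only: nn_integral_cmult nn_integral_Gamma[OF _ zero_less_one] powr_one_eq_one div_by_1)
  qed
  also have "\<dots> = ennreal (sqrt (\<nu> * pi) * Gamma (\<nu> / 2))"
    using assms by (intro ennreal_mult'[symmetric]) simp
  finally have *: "(\<integral>\<^sup>+x. ennreal (Gamma a * (1 + x\<^sup>2 / \<nu>) powr (- a)) \<partial>lborel)
      = ennreal (sqrt (\<nu> * pi) * Gamma (\<nu> / 2))" .
  have g: "0 < sqrt (\<nu> * pi) * Gamma (\<nu> / 2)"
    using assms by (simp add: Gamma_real_pos)
  have eq: "t_density \<nu> x = 1 / (sqrt (\<nu> * pi) * Gamma (\<nu> / 2)) * (Gamma a * (1 + x\<^sup>2 / \<nu>) powr (- a))" for x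

  proof -
    have "- (\<nu> + 1) / 2 = - a" by (simp only: a_def minus_divide_left)
    then show ?thesis by (simp only: t_density_def a_def[symmetric]) simp
  qed
  have "(\<integral>\<^sup>+x. ennreal (t_density \<nu> x) \<partial>lborel)
      = ennreal (1 / (sqrt (\<nu> * pi) * Gamma (\<nu> / 2))) * ennreal (sqrt (\<nu> * pi) * Gamma (\<nu> / 2))"
  proof -
    have "ennreal (t_density \<nu> x) = ennreal (1 / (sqrt (\<nu> * pi) * Gamma (\<nu> / 2))) *
        ennreal (Gamma a * (1 + x\<^sup>2 / \<nu>) powr (- a))" for x
      unfolding eq using g by (intro ennreal_mult') simp
    then show ?thesis
      by (simp only: *[symmetric]) (rule nn_integral_cmult, measurable)
  qed
  also have "\<dots> = 1"
    using g by (subst ennreal_mult'[symmetric]) auto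
  finally show ?thesis .
qed

lemma symmetric_density_t:
  assumes "0 < \<nu>"
  shows "symmetric_density (t_density \<nu>) (F_t \<nu>)"
proof
  have pos: "0 < 1 + x\<^sup>2 / \<nu>" for x using assms by (simp add: add_pos_nonneg)
  show "isCont (t_density \<nu>) x" for x
  proof -
    have "isCont (\<lambda>x. 1 + x\<^sup>2 / \<nu>) x"
      using assms by (intro continuous_intros) simp
    then have "isCont (\<lambda>x. (1 + x\<^sup>2 / \<nu>) powr (- (\<nu> + 1) / 2)) x"
      using pos[of x] by (intro continuous_at_within_powr continuous_const) simp_all
    then show ?thesis
      unfolding t_density_def[abs_def] by (intro isCont_mult continuous_const)
  qed
  show "0 < t_density \<nu> x" for x
  proof -
    have "0 < Gamma ((\<nu> + 1) / 2)" "0 < Gamma (\<nu> / 2)" "0 < sqrt (\<nu> * pi)"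
      using assms by (simp_all add: Gamma_real_pos)
    moreover have "0 < (1 + x\<^sup>2 / \<nu>) powr (- (\<nu> + 1) / 2)"
      using pos[of x] by simp
    ultimately show ?thesis
      unfolding t_density_def by (intro mult_pos_pos divide_pos_pos)
  qed
  show "(\<integral>\<^sup>+x. ennreal (t_density \<nu> x) \<partial>lborel) = 1"
    using assms by (rule nn_integral_t_density)
  show "t_density \<nu> (- x) = t_density \<nu> x" for x
    by (simp add: t_density_def)
  show "F_t \<nu> x = (LINT y:{..x}|lborel. t_density \<nu> y)" for x
    by (rule F_t_def)
qed

section \<open>Crossing points\<close>

text \<open>The derivative d - k / (\<nu> + w) is increasing, so r is convex on w \<ge> 0 and
  changes sign at most twice; the linear term makes it positive in the end. Nothing is claimed at a
  and b themselves, so the degenerate cases a = 0 (r negative at 0) and a = b (r never negative) fit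
  the same statement.\<close>

lemma log_ratio_shape:
  fixes C k d \<nu> :: real
  assumes "0 < k" "0 < d" "0 < \<nu>"
  defines "r \<equiv> \<lambda>w. C - k * ln (1 + w / \<nu>) + d * w"
  obtains a b where "0 \<le> a" "a \<le> b" "\<And>w. 0 \<le> w \<Longrightarrow> w < a \<Longrightarrow> 0 < r w"
    "\<And>w. a < w \<Longrightarrow> w < b \<Longrightarrow> r w < 0" "\<And>w. b < w \<Longrightarrow> 0 < r w"
proof -
  \<comment> \<open>The minimiser of r on w \<ge> 0: the zero of its derivative, or 0 if that zero
    is negative.\<close>
  define w0 where "w0 = max 0 (k / d - \<nu>)"
  have w0: "0 \<le> w0" by (simp add: w0_def)
  have deriv: "(r has_real_derivative d - k / (\<nu> + w)) (at w)" if "0 \<le> w" for w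
  proof -
    have "0 < 1 + w / \<nu>" using that assms by (simp add: add_pos_nonneg)
    then have "(r has_real_derivative - (k * (1 / \<nu> / (1 + w / \<nu>))) + d) (at w)"
      unfolding r_def using assms by (auto intro!: derivative_eq_intros)
    moreover have "1 / \<nu> / (1 + w / \<nu>) = 1 / (\<nu> + w)"
      using that assms by (simp add: field_simps)
    ultimately show ?thesis by simp
  qed
  have cont: "continuous_on {x..y} r" if "0 \<le> x" for x y
    using that by (intro continuous_at_imp_continuous_on ballI DERIV_isCont[OF deriv]) simp
  have dec: "r y < r x" if "0 \<le> x" "x < y" "y \<le> w0" for x y
  proof (rule DERIV_neg_imp_decreasing_open[OF \<open>x < y\<close>])
    fix z assume z: "x < z" "z < y"
    have "z < k / d - \<nu>" using z that by (simp add: w0_def max_def split: if_splits)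
    then have "d * (\<nu> + z) < k" using assms by (simp add: field_simps)
    then have "d - k / (\<nu> + z) < 0" using z that assms by (simp add: field_simps)
    then show "\<exists>y. (r has_real_derivative y) (at z) \<and> y < 0"
      using deriv[of z] z that by auto
  qed (use cont that in auto)
  have inc: "r x < r y" if "w0 \<le> x" "x < y" for x y
  proof (rule DERIV_pos_imp_increasing_open[OF \<open>x < y\<close>])
    fix z assume z: "x < z" "z < y"
    have "0 < z" using z that w0 by linarith
    have "k / d - \<nu> < z" using z that by (simp add: w0_def)
    then have "k < d * (\<nu> + z)" using assms by (simp add: field_simps)
    then have "0 < d - k / (\<nu> + z)" using \<open>0 < z\<close> assms by (simp add: field_simps)
    then show "\<exists>y. (r has_real_derivative y) (at z) \<and> 0 < y"
      using deriv[of z] \<open>0 < z\<close> by auto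
  qed (use cont that w0 in auto)
  show thesis
  proof (cases "0 \<le> r w0")
    case True
    show thesis
    proof (rule that[of w0 w0])
      show "0 < r w" if "0 \<le> w" "w < w0" for w using dec[of w w0] that True by simp
      show "0 < r w" if "w0 < w" for w using inc[of w0 w] that True by simp
    qed (use w0 in auto)
  next
    case False
    have "filterlim r at_top at_top"
      unfolding r_def using assms by real_asymp
    then have "eventually (\<lambda>w. 0 < r w \<and> w0 < w) at_top"
      by (intro eventually_conj) (auto simp: filterlim_at_top_dense eventually_gt_at_top)
    then obtain B where B: "0 < r B" "w0 < B"
      by (metis (lifting) eventually_happens' trivial_limit_at_top_linorder)
    obtain b where b: "w0 \<le> b" "r b = 0"
      using IVT'[of r w0 0 B] False B cont[OF w0] by auto
    obtain a where a: "0 \<le> a" "a \<le> w0" "\<And>w. 0 \<le> w \<Longrightarrow> w < a \<Longrightarrow> 0 < r w"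
      "\<And>w. a < w \<Longrightarrow> w \<le> w0 \<Longrightarrow> r w < 0"
    proof (cases "0 \<le> r 0")
      case True
      obtain a where a: "0 \<le> a" "a \<le> w0" "r a = 0"
        using IVT2'[of r w0 0 0] False True cont[of 0 w0] w0 by auto
      show thesis
      proof (rule that[of a])
        show "0 < r w" if "0 \<le> w" "w < a" for w using dec[of w a] that a by simp
        show "r w < 0" if "a < w" "w \<le> w0" for w using dec[of a w] that a by simp
      qed (use a in auto)
    next
      case neg: False
      show thesis
      proof (rule that[of 0])
        show "r w < 0" if "0 < w" "w \<le> w0" for w using dec[of 0 w] that neg by simp
      qed (use w0 in auto)
    qed
    show thesis
    proof (rule that[of a b])
      show "r w < 0" if "a < w" "w < b" for w
      proof (cases "w \<le> w0")
        case False
        then show ?thesis using inc[of w b] that b by simp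
      qed (use a that in auto)
      show "0 < r w" if "b < w" for w using inc[of b w] that b by simp
    qed (use a b in auto)
  qed
qed

section \<open>The gap function and its shape\<close>

locale crossing =
  fixes \<alpha> \<nu> :: real
  assumes alpha: "0 < \<alpha>" "\<alpha> \<le> 1 / 2"
    and nu: "0 < \<nu>"
begin

sublocale t: symmetric_density "t_density \<nu>" "F_t \<nu>"
  using nu by (rule symmetric_density_t)

text \<open>In the coordinate \<open>u\<close> with \<open>t = F_t (- u)\<close>, this is
  \<open>\<alpha> * (F_inf s t - t / \<alpha>)\<close>.\<close>

definition gap :: "real \<Rightarrow> real \<Rightarrow> real" where
  "gap s u = \<alpha> * Phi (- (s * u)) - F_t \<nu> (- u)"

definition gap' :: "real \<Rightarrow> real \<Rightarrow> real" where
  "gap' s u = t_density \<nu> u - s * \<alpha> * std_normal_density (s * u)"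

lemma DERIV_gap: "(gap s has_real_derivative gap' s u) (at u)"
proof -
  have "((\<lambda>u. Phi (- (s * u))) has_real_derivative std_normal_density (- (s * u)) * (- s)) (at u)"
    by (rule DERIV_chain2[OF normal.DERIV_F]) (auto intro!: derivative_eq_intros)
  moreover have "((\<lambda>u. F_t \<nu> (- u)) has_real_derivative t_density \<nu> (- u) * (- 1)) (at u)"
    by (rule DERIV_chain2[OF t.DERIV_F]) (auto intro!: derivative_eq_intros)
  ultimately have "((\<lambda>u. \<alpha> * Phi (- (s * u)) - F_t \<nu> (- u)) has_real_derivative
      \<alpha> * (std_normal_density (- (s * u)) * (- s)) - t_density \<nu> (- u) * (- 1)) (at u)"
    by (intro DERIV_diff DERIV_cmult)
  moreover have "\<alpha> * (std_normal_density (- (s * u)) * (- s)) - t_density \<nu> (- u) * (- 1) = gap' s u"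
    unfolding gap'_def normal.even t.even by simp
  ultimately show ?thesis unfolding gap_def[abs_def] by simp
qed

lemma continuous_gap: "continuous_on A (gap s)"
  by (intro continuous_at_imp_continuous_on ballI DERIV_isCont[OF DERIV_gap])

lemma gap_0: "gap s 0 < 0"
  using alpha by (simp add: gap_def normal.F_0 t.F_0)

lemma gap_strict_antimono: "s < s' \<Longrightarrow> 0 < u \<Longrightarrow> gap s' u < gap s u"
  using alpha by (simp add: gap_def)

lemma gap_at_top:
  assumes "0 < s"
  shows "(gap s \<longlongrightarrow> 0) at_top"
proof -
  have "filterlim (\<lambda>u. - (s * u)) at_bot at_top" "filterlim (\<lambda>u::real. - u) at_bot at_top"
    using assms by real_asymp+
  then have "((\<lambda>u. \<alpha> * Phi (- (s * u)) - F_t \<nu> (- u)) \<longlongrightarrow> \<alpha> * 0 - 0) at_top"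
    by (intro tendsto_intros filterlim_compose[OF normal.F_at_bot] filterlim_compose[OF t.F_at_bot])
  then show ?thesis by (simp add: gap_def[abs_def])
qed

text \<open>The logarithm of the ratio of the two terms of \<open>gap'\<close> is, as a function of
  \<open>w = u\<^sup>2\<close>, first decreasing and then increasing to infinity.\<close>

lemma gap'_shape:
  assumes "0 < s"
  obtains a b where "0 \<le> a" "a \<le> b" "\<And>u. 0 \<le> u \<Longrightarrow> u < a \<Longrightarrow> 0 < gap' s u"
    "\<And>u. a < u \<Longrightarrow> u < b \<Longrightarrow> gap' s u < 0" "\<And>u. b < u \<Longrightarrow> 0 < gap' s u"
proof -
  define c where "c = Gamma ((\<nu> + 1) / 2) / (sqrt (\<nu> * pi) * Gamma (\<nu> / 2))"
  define c' where "c' = s * \<alpha> / sqrt (2 * pi)"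
  define k where "k = (\<nu> + 1) / 2"
  \<comment> \<open>The logarithm of \<open>t_density \<nu> u\<close> divided by
    \<open>s * \<alpha> * std_normal_density (s * u)\<close>, written in w; it has the sign of
    \<open>gap'\<close>.\<close>
  define r where "r w = ln c - ln c' - k * ln (1 + w / \<nu>) + s\<^sup>2 / 2 * w" for w
  have c: "0 < c" "0 < c'" "0 < k"
    using nu assms alpha Gamma_real_pos[of "(\<nu> + 1) / 2"] Gamma_real_pos[of "\<nu> / 2"]
    by (simp_all add: c_def c'_def k_def)
  have t: "t_density \<nu> u = exp (ln c - k * ln (1 + u\<^sup>2 / \<nu>))" for u
  proof -
    have pos: "0 < 1 + u\<^sup>2 / \<nu>" using nu by (simp add: add_pos_nonneg)
    have k: "- (\<nu> + 1) / 2 = - k" by (simp only: k_def minus_divide_left)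
    have "t_density \<nu> u = c * (1 + u\<^sup>2 / \<nu>) powr (- k)"
      unfolding t_density_def c_def k ..
    also have "\<dots> = exp (ln c - k * ln (1 + u\<^sup>2 / \<nu>))"
      using c pos by (simp add: powr_def diff_conv_add_uminus exp_add del: add_uminus_conv_diff)
    finally show ?thesis .
  qed
  have rw: "ln c' - s\<^sup>2 / 2 * u\<^sup>2 = ln c' + - (s * u)\<^sup>2 / 2" for u
    by (simp add: power_mult_distrib)
  have n: "s * \<alpha> * std_normal_density (s * u) = exp (ln c' - s\<^sup>2 / 2 * u\<^sup>2)" for u
    using c unfolding std_normal_density_def rw exp_add by (simp add: c'_def)
  have pos: "0 < gap' s u \<longleftrightarrow> 0 < r (u\<^sup>2)" and neg: "gap' s u < 0 \<longleftrightarrow> r (u\<^sup>2) < 0" for u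
    unfolding gap'_def t n r_def by auto
  obtain a b where ab: "0 \<le> a" "a \<le> b" "\<And>w. 0 \<le> w \<Longrightarrow> w < a \<Longrightarrow> 0 < r w"
    "\<And>w. a < w \<Longrightarrow> w < b \<Longrightarrow> r w < 0" "\<And>w. b < w \<Longrightarrow> 0 < r w"
    using log_ratio_shape[of k "s\<^sup>2 / 2" \<nu> "ln c - ln c'"] c assms nu unfolding r_def by auto
  have sq: "u < sqrt x \<longleftrightarrow> u\<^sup>2 < x" "sqrt x < u \<longleftrightarrow> x < u\<^sup>2" if "0 \<le> u" "0 \<le> x" for u x :: real
    using real_sqrt_less_iff[of "u\<^sup>2" x] real_sqrt_less_iff[of x "u\<^sup>2"] that by simp_all
  show thesis
  proof (rule that[of "sqrt a" "sqrt b"])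
    show "0 < gap' s u" if "0 \<le> u" "u < sqrt a" for u
      using that ab sq unfolding pos by simp
    show "gap' s u < 0" if "sqrt a < u" "u < sqrt b" for u
    proof -
      have "0 \<le> u" using that ab real_sqrt_ge_zero[of a] by linarith
      then show ?thesis using that ab sq[of u a] sq[of u b] unfolding neg by simp
    qed
    show "0 < gap' s u" if "sqrt b < u" for u
    proof -
      have "0 \<le> u" using that ab real_sqrt_ge_zero[of b] by linarith
      then show ?thesis using that ab sq[of u b] unfolding pos by simp
    qed
  qed (use ab in auto)
qed

text \<open>The signs of the derivative are returned along with the monotonicity, because the
  tangency argument must recognise a zero of \<open>gap'\<close> as the maximum point a.\<close>

lemma gap_shape:
  assumes "0 < s"
  obtains a b where "0 \<le> a" "a \<le> b" "\<And>u v. 0 \<le> u \<Longrightarrow> u < v \<Longrightarrow> v \<le> a \<Longrightarrow> gap s u < gap s v"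
    "\<And>u v. a \<le> u \<Longrightarrow> u < v \<Longrightarrow> v \<le> b \<Longrightarrow> gap s v < gap s u" "\<And>u. b \<le> u \<Longrightarrow> gap s u < 0"
    "\<And>u. a < u \<Longrightarrow> u < b \<Longrightarrow> gap' s u < 0" "\<And>u. 0 \<le> u \<Longrightarrow> u < a \<Longrightarrow> 0 < gap' s u"
proof -
  obtain a b where ab: "0 \<le> a" "a \<le> b" "\<And>u. 0 \<le> u \<Longrightarrow> u < a \<Longrightarrow> 0 < gap' s u"
    "\<And>u. a < u \<Longrightarrow> u < b \<Longrightarrow> gap' s u < 0" "\<And>u. b < u \<Longrightarrow> 0 < gap' s u"
    using gap'_shape[OF assms] by metis
  have inc: "gap s u < gap s v" if "u < v" "\<And>w. u < w \<Longrightarrow> w < v \<Longrightarrow> 0 < gap' s w" for u v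
    by (rule DERIV_pos_imp_increasing_open[OF \<open>u < v\<close>]) (use that DERIV_gap continuous_gap in blast)+
  have dec: "gap s v < gap s u" if "u < v" "\<And>w. u < w \<Longrightarrow> w < v \<Longrightarrow> gap' s w < 0" for u v
    by (rule DERIV_neg_imp_decreasing_open[OF \<open>u < v\<close>]) (use that DERIV_gap continuous_gap in blast)+
  have tail: "gap s u < 0" if "b \<le> u" for u
  proof (rule ccontr)
    assume "\<not> gap s u < 0"
    \<comment> \<open>Moving on by 1 turns a nonnegative value into a positive one, which even the
      weak comparison with the limit 0 refutes.\<close>
    moreover have "gap s u < gap s (u + 1)" by (rule inc) (use that ab in auto)
    ultimately have pos: "0 < gap s (u + 1)" by simp
    have "gap s (u + 1) \<le> 0"
    proof (rule tendsto_lowerbound[OF gap_at_top[OF assms]])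
      show "eventually (\<lambda>v. gap s (u + 1) \<le> gap s v) at_top"
        using eventually_gt_at_top[of "u + 1"]
      proof eventually_elim
        case (elim v)
        have "gap s (u + 1) < gap s v" by (rule inc) (use elim that ab in auto)
        then show ?case by simp
      qed
    qed simp
    with pos show False by simp
  qed
  show thesis
    by (rule that[of a b]) (use ab inc dec tail in auto)
qed

text \<open>A positive value at w excludes the last branch, so w < b; the rise from v to w then
  excludes v \<ge> a. Hence v lies on the first, increasing branch and everything before v is
  smaller. All later uniqueness and sign claims about crossings rest on this.\<close>

lemma gap_neg_before:
  assumes "0 < s" "0 \<le> u" "u < v" "v < w" "gap s v \<le> 0" "0 < gap s w"
  shows "gap s u < 0"
proof -
  obtain a b where ab: "0 \<le> a" "a \<le> b" "\<And>u v. 0 \<le> u \<Longrightarrow> u < v \<Longrightarrow> v \<le> a \<Longrightarrow> gap s u < gap s v"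
    "\<And>u v. a \<le> u \<Longrightarrow> u < v \<Longrightarrow> v \<le> b \<Longrightarrow> gap s v < gap s u" "\<And>u. b \<le> u \<Longrightarrow> gap s u < 0"
    "\<And>u. a < u \<Longrightarrow> u < b \<Longrightarrow> gap' s u < 0" "\<And>u. 0 \<le> u \<Longrightarrow> u < a \<Longrightarrow> 0 < gap' s u"
    by (rule gap_shape[OF assms(1)]; rule that; blast)
  have "w < b" using ab(5)[of w] assms by (meson less_asym not_le)
  have "v < a"
  proof (rule ccontr)
    assume "\<not> v < a"
    then have "gap s w < gap s v" using ab(4)[of v w] \<open>w < b\<close> assms by simp
    then show False using assms by simp
  qed
  then show ?thesis using ab(3)[of u v] assms by simp
qed

text \<open>A zero of \<open>gap\<close> lies before b, and a zero of \<open>gap'\<close> before b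
  can only be a. So the line is touched at the maximum point, and the maximum value is 0.\<close>

lemma gap_tangent:
  assumes "0 < s" "0 < u" "gap s u = 0" "gap' s u = 0" "0 \<le> v" "v \<noteq> u"
  shows "gap s v < 0"
proof -
  obtain a b where ab: "0 \<le> a" "a \<le> b" "\<And>u v. 0 \<le> u \<Longrightarrow> u < v \<Longrightarrow> v \<le> a \<Longrightarrow> gap s u < gap s v"
    "\<And>u v. a \<le> u \<Longrightarrow> u < v \<Longrightarrow> v \<le> b \<Longrightarrow> gap s v < gap s u" "\<And>u. b \<le> u \<Longrightarrow> gap s u < 0"
    "\<And>u. a < u \<Longrightarrow> u < b \<Longrightarrow> gap' s u < 0" "\<And>u. 0 \<le> u \<Longrightarrow> u < a \<Longrightarrow> 0 < gap' s u"
    by (rule gap_shape[OF assms(1)]; rule that; blast)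
  have "u < b" using ab(5)[of u] assms by force
  then have "u = a" using ab(6)[of u] ab(7)[of u] assms by (cases u a rule: linorder_cases) auto
  consider "v < u" | "u < v" "v < b" | "b \<le> v" using assms by linarith
  then show ?thesis
  proof cases
    case 1
    then show ?thesis using ab(3)[of v u] assms \<open>u = a\<close> by simp
  next
    case 2
    then show ?thesis using ab(4)[of u v] assms \<open>u = a\<close> by simp
  qed (rule ab)
qed

section \<open>Translating crossings between t and u\<close>

lemma F_t_inv_F_t: "F_t_inv \<nu> (1 - F_t \<nu> (- u)) = u"
  using t.the_F[of u] by (simp add: F_t_inv_def t.F_minus)

lemma F_t_cases:
  assumes "0 < x" "x < 1"
  obtains u where "x = F_t \<nu> (- u)"
  using t.F_surj[OF assms] by (metis minus_minus)

lemma F_inf_F_t: "F_inf \<nu> s (F_t \<nu> (- u)) = Phi (- (s * u))"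
  using t.F_pos[of "- u"] t.F_less_1[of "- u"]
  by (simp add: F_inf_def F_t_inv_F_t normal.F_minus)

lemma F_inf_iff:
  "F_inf \<nu> s (F_t \<nu> (- u)) = F_t \<nu> (- u) / \<alpha> \<longleftrightarrow> gap s u = 0"
  "F_inf \<nu> s (F_t \<nu> (- u)) < F_t \<nu> (- u) / \<alpha> \<longleftrightarrow> gap s u < 0"
  "F_inf \<nu> s (F_t \<nu> (- u)) > F_t \<nu> (- u) / \<alpha> \<longleftrightarrow> gap s u > 0"
  using alpha by (auto simp: F_inf_F_t gap_def field_simps)

text \<open>Since t decreases in u, the largest crossing t is the first zero in u; points of
  [0, \<alpha>] have u \<ge> 0 because \<alpha> \<le> 1/2.\<close>

lemma t_cross_eq:
  assumes "0 \<le> u" "gap s u = 0" "\<And>v. 0 \<le> v \<Longrightarrow> v < u \<Longrightarrow> gap s v \<noteq> 0"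
  shows "t_cross \<nu> \<alpha> s = F_t \<nu> (- u)"
  unfolding t_cross_def
proof (rule cSup_eq_maximum)
  have "F_t \<nu> (- u) = \<alpha> * Phi (- (s * u))" using assms by (simp add: gap_def)
  also have "\<dots> \<le> \<alpha> * 1"
    using alpha normal.F_less_1 by (intro mult_left_mono) (auto intro: less_imp_le)
  finally show "F_t \<nu> (- u) \<in> {t \<in> {0..\<alpha>}. F_inf \<nu> s t = t / \<alpha>}"
    using assms t.F_pos[of "- u"] by (simp add: F_inf_iff)
next
  fix x assume x: "x \<in> {t \<in> {0..\<alpha>}. F_inf \<nu> s t = t / \<alpha>}"
  show "x \<le> F_t \<nu> (- u)"
  proof (cases "0 < x")
    case True
    then obtain v where v: "x = F_t \<nu> (- v)" using F_t_cases[of x] x alpha by auto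
    have "F_t \<nu> (- v) \<le> F_t \<nu> 0" using x v alpha by (simp add: t.F_0 del: t.F_le_iff)
    then have "0 \<le> v" by simp
    moreover have "gap s v = 0" using x v by (simp add: F_inf_iff)
    ultimately have "\<not> v < u" using assms by auto
    then show ?thesis using v by simp
  qed (use t.F_pos[of "- u"] in simp)
qed

text \<open>The point 0 is always a crossing, since \<open>F_inf\<close> vanishes there; it is the
  supremum when no other crossing exists.\<close>

lemma t_cross_eq_0:
  assumes "\<And>u. 0 \<le> u \<Longrightarrow> gap s u \<noteq> 0"
  shows "t_cross \<nu> \<alpha> s = 0"
  unfolding t_cross_def
proof (rule cSup_eq_maximum)
  show "0 \<in> {t \<in> {0..\<alpha>}. F_inf \<nu> s t = t / \<alpha>}" using alpha by (simp add: F_inf_def)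
next
  fix x assume x: "x \<in> {t \<in> {0..\<alpha>}. F_inf \<nu> s t = t / \<alpha>}"
  show "x \<le> 0"
  proof (rule ccontr)
    assume "\<not> x \<le> 0"
    then obtain v where v: "x = F_t \<nu> (- v)" using F_t_cases[of x] x alpha by auto
    have "F_t \<nu> (- v) \<le> F_t \<nu> 0" using x v alpha by (simp add: t.F_0 del: t.F_le_iff)
    then have "0 \<le> v" by simp
    moreover have "gap s v = 0" using x v by (simp add: F_inf_iff)
    ultimately show False using assms by auto
  qed
qed

text \<open>A zero of the gap says 1 - t / \<alpha> = Phi (s u); the normal quantile gives s u, and
  division by u, the t quantile, recovers s. The next lemma is the converse.\<close>

lemma s_cross_eq:
  assumes "gap s u = 0" "u \<noteq> 0"
  shows "s_cross \<nu> \<alpha> (F_t \<nu> (- u)) = s"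
proof -
  have "1 - F_t \<nu> (- u) / \<alpha> = Phi (s * u)"
    using assms alpha by (simp add: gap_def normal.F_minus field_simps)
  then show ?thesis
    using assms normal.the_F[of "s * u"] by (simp add: s_cross_def F_t_inv_F_t Phi_inv_def)
qed

lemma gap_s_cross:
  assumes "u \<noteq> 0" "F_t \<nu> (- u) < \<alpha>"
  shows "gap (s_cross \<nu> \<alpha> (F_t \<nu> (- u))) u = 0"
proof -
  let ?p = "1 - F_t \<nu> (- u) / \<alpha>"
  have p: "0 < ?p" "?p < 1" using assms alpha t.F_pos[of "- u"] by simp_all
  have "Phi (s_cross \<nu> \<alpha> (F_t \<nu> (- u)) * u) = ?p"
    using assms normal.F_the[OF p] by (simp add: s_cross_def F_t_inv_F_t Phi_inv_def)
  then show ?thesis using alpha by (simp add: gap_def normal.F_minus field_simps)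
qed

text \<open>Origin of the bound \<alpha> / 2: the normal term equals \<alpha> / 2 at s = 0 and is
  smaller exactly for s > 0.\<close>

lemma gap_zero_less:
  assumes "gap s u = 0" "0 < u"
  shows "0 < s \<longleftrightarrow> F_t \<nu> (- u) < \<alpha> / 2"
proof -
  have "F_t \<nu> (- u) < \<alpha> / 2 \<longleftrightarrow> Phi (- (s * u)) < Phi 0"
  proof -
    have "F_t \<nu> (- u) = \<alpha> * Phi (- (s * u))" using assms by (simp add: gap_def)
    then show ?thesis using alpha by (simp only: normal.F_0) (simp add: field_simps)
  qed
  then show ?thesis using assms by (simp add: zero_less_mult_iff)
qed

end

section \<open>The tangent point and the set of largest crossing points\<close>

locale tangent_point = crossing +
  fixes t2 :: real
  assumes tangent: "is_tangent_point \<nu> \<alpha> t2"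
begin

definition u2 :: real where "u2 = F_t_inv \<nu> (1 - t2)"

text \<open>Taken from \<open>s_cross\<close>, the form in which the limits mention it;
  \<open>tangent_facts\<close> identifies it with the scale of the tangency.\<close>

definition s2 :: real where "s2 = s_cross \<nu> \<alpha> t2"

lemma tangent_facts:
  shows t2: "t2 = F_t \<nu> (- u2)" and u2: "0 < u2" and s2: "0 < s2"
    and gap_s2: "gap s2 u2 = 0" and gap'_s2: "gap' s2 u2 = 0"
proof -
  obtain u where u: "t2 = F_t \<nu> (- u)"
    using tangent F_t_cases[of t2] by (auto simp: is_tangent_point_def)
  have [simp]: "u2 = u" using F_t_inv_F_t[of u] unfolding u[symmetric] u2_def .
  show "t2 = F_t \<nu> (- u2)" by (simp only: \<open>u2 = u\<close> u[symmetric])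
  obtain s where s: "0 < s" "\<alpha> * Phi (- s * u) = F_t \<nu> (- u)"
    "s * \<alpha> * std_normal_density (s * u) = t_density \<nu> u"
    using tangent unfolding is_tangent_point_def Let_def
    using F_t_inv_F_t[of u, folded u] by (simp only: u) blast
  \<comment> \<open>As Phi < 1, the tangent point is below \<alpha> \<le> 1/2, and therefore u2 >
    0.\<close>
  have "F_t \<nu> (- u) < \<alpha> * 1"
    unfolding s(2)[symmetric] using alpha normal.F_less_1 by (intro mult_strict_left_mono)
  also have "\<dots> \<le> F_t \<nu> 0" using alpha by (simp add: t.F_0)
  finally show "0 < u2" by simp
  have gap: "gap s u = 0" using s by (simp add: gap_def)
  have "s2 = s"
    using s_cross_eq[OF gap] \<open>0 < u2\<close> unfolding s2_def u[symmetric] by simp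
  then show "0 < s2" "gap s2 u2 = 0" "gap' s2 u2 = 0"
    using s gap by (simp_all add: gap'_def)
qed

lemma t2_pos: "0 < t2"
  using t.F_pos[of "- u2"] by (simp only: t2[symmetric])

lemma t2_less_iff: "t2 < F_t \<nu> (- u) \<longleftrightarrow> u < u2"
proof -
  have "F_t \<nu> (- u2) < F_t \<nu> (- u) \<longleftrightarrow> u < u2" by simp
  then show ?thesis by (simp only: t2[symmetric])
qed

lemma less_t2_iff: "F_t \<nu> (- u) < t2 \<longleftrightarrow> u2 < u"
proof -
  have "F_t \<nu> (- u) < F_t \<nu> (- u2) \<longleftrightarrow> u2 < u" by simp
  then show ?thesis by (simp only: t2[symmetric])
qed

lemma gap_s2_neg: "0 \<le> v \<Longrightarrow> v \<noteq> u2 \<Longrightarrow> gap s2 v < 0"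
  using gap_tangent[OF s2 u2 gap_s2 gap'_s2] by blast

lemma gap_neg_above:
  assumes "s2 < s" "0 \<le> v"
  shows "gap s v < 0"
proof (cases "v = 0")
  case True
  then show ?thesis by (simp add: gap_0)
next
  case False
  then have "gap s v < gap s2 v" using assms by (intro gap_strict_antimono) auto
  also have "\<dots> \<le> 0" using gap_s2_neg[of v] gap_s2 assms by (cases "v = u2") auto
  finally show ?thesis .
qed

lemma gap_pos_below: "s < s2 \<Longrightarrow> 0 < gap s u2"
  using gap_strict_antimono[of s s2 u2] gap_s2 u2 by simp

text \<open>A crossing before u2 (that is, with t above t2) forces s < s2, as \<open>gap s2\<close>
  is negative there. Then \<open>gap s u2\<close> is positive, and \<open>gap_neg_before\<close>
  with this positive value fixes the sign on both sides of u.\<close>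

lemma cross_before:
  assumes "0 < s" "0 < u" "u < u2" "gap s u = 0"
  shows "s < s2" "\<And>v. 0 \<le> v \<Longrightarrow> v < u \<Longrightarrow> gap s v < 0"
    "\<And>v. u < v \<Longrightarrow> v \<le> u2 \<Longrightarrow> 0 < gap s v"
proof -
  show "s < s2"
  proof (rule ccontr)
    assume "\<not> s < s2"
    then have "gap s u \<le> gap s2 u"
      using gap_strict_antimono[of s2 s u] assms by (cases "s = s2") auto
    then show False using gap_s2_neg[of u] assms by simp
  qed
  then have pos: "0 < gap s u2" by (rule gap_pos_below)
  show "gap s v < 0" if "0 \<le> v" "v < u" for v
    by (rule gap_neg_before[OF assms(1) that assms(3)]) (use assms pos in auto)
  show "0 < gap s v" if "u < v" "v \<le> u2" for v
  proof (rule ccontr)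
    assume neg: "\<not> 0 < gap s v"
    then have "v < u2" using pos that by (cases "v = u2") auto
    have "gap s u < 0"
      by (rule gap_neg_before[OF assms(1) _ that(1) \<open>v < u2\<close>]) (use assms pos neg in auto)
    then show False using assms by simp
  qed
qed

lemma F_inf_right:
  assumes "0 \<le> x" "x < y" "y \<le> 1 / 2" "\<And>v. 0 \<le> v \<Longrightarrow> x < F_t \<nu> (- v) \<Longrightarrow> gap s v < 0"
  shows "F_inf \<nu> s y < y / \<alpha>"
proof -
  obtain v where v: "y = F_t \<nu> (- v)" using F_t_cases[of y] assms by auto
  have "F_t \<nu> (- v) \<le> F_t \<nu> 0" using assms v by (simp add: t.F_0 del: t.F_le_iff)
  then have "0 \<le> v" by simp
  then show ?thesis using assms(4)[of v] assms(2) v by (simp add: F_inf_iff)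
qed

lemma is_LCP_0: "is_LCP \<nu> \<alpha> 0"
  unfolding is_LCP_def
\<comment> \<open>Any scale above s2 serves: the gap is then negative for all u \<ge> 0, so 0 is the
  only crossing.\<close>
proof (rule exI[of _ "s2 + 1"], intro conjI)
  have neg: "gap (s2 + 1) v < 0" if "0 \<le> v" for v
    using that by (intro gap_neg_above) auto
  then show "0 = t_cross \<nu> \<alpha> (s2 + 1)"
    by (subst t_cross_eq_0) (auto dest: less_imp_neq)
  show "\<exists>\<epsilon>>0. \<forall>x\<in>{0<..<0 + \<epsilon>}. F_inf \<nu> (s2 + 1) x < x / \<alpha>"
    by (rule exI[of _ "1 / 2"]) (auto intro!: F_inf_right[of 0] neg)
qed (use s2 in auto)

lemma is_LCP_cross:
  assumes "t2 < x" "x < \<alpha> / 2"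
  shows "is_LCP \<nu> \<alpha> x"
proof -
  obtain u where x: "x = F_t \<nu> (- u)" using F_t_cases[of x] assms alpha t2_pos by auto
  define s where "s = s_cross \<nu> \<alpha> x"
  have "u < u2" using assms unfolding x by (simp add: t2_less_iff)
  have "F_t \<nu> (- u) < F_t \<nu> 0" using assms alpha by (simp add: x t.F_0 del: t.F_less_iff)
  then have "0 < u" by simp
  have gap: "gap s u = 0"
    unfolding s_def x by (rule gap_s_cross) (use \<open>0 < u\<close> assms alpha x in auto)
  have "0 < s" using gap_zero_less[OF gap \<open>0 < u\<close>] assms x by simp
  note cross = cross_before[OF \<open>0 < s\<close> \<open>0 < u\<close> \<open>u < u2\<close> gap]
  show ?thesis
    unfolding is_LCP_def
  proof (rule exI[of _ s], intro conjI disjI2)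
    show "x = t_cross \<nu> \<alpha> s"
      unfolding x using \<open>0 < u\<close> gap cross(2) by (intro t_cross_eq[symmetric]) force+
    \<comment> \<open>The left neighbourhood reaches down to t2, where the positive stretch between
      u and u2 is known; the right one reaches up to t = 1/2, where u = 0.\<close>
    show "\<exists>\<epsilon>>0. \<forall>y\<in>{x - \<epsilon><..<x}. y / \<alpha> < F_inf \<nu> s y"
    proof (intro exI[of _ "x - t2"] conjI ballI)
      fix y assume y: "y \<in> {x - (x - t2)<..<x}"
      then obtain v where v: "y = F_t \<nu> (- v)" using F_t_cases[of y] assms alpha t2_pos by auto
      have "u < v" "v < u2" using y by (simp_all add: v x t2_less_iff)
      then show "y / \<alpha> < F_inf \<nu> s y" using cross(3)[of v] v by (simp add: F_inf_iff)
    qed (use assms in auto)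
    show "\<exists>\<epsilon>>0. \<forall>y\<in>{x<..<x + \<epsilon>}. F_inf \<nu> s y < y / \<alpha>"
    proof (intro exI[of _ "1 / 2 - x"] conjI ballI)
      fix y assume "y \<in> {x<..<x + (1 / 2 - x)}"
      then show "F_inf \<nu> s y < y / \<alpha>"
        using assms t2_pos cross(2) by (intro F_inf_right[of x]) (auto simp: x)
    qed (use assms alpha in auto)
  qed fact
qed

text \<open>For s < s2 the intermediate value theorem between 0 and u2 yields the crossing, so it
  lies above t2. At s = s2 the crossing is t2 itself, but the curve stays below the line on its left
  as well; this is why t2 is excluded.\<close>

lemma LCP_cases:
  assumes "is_LCP \<nu> \<alpha> x"
  shows "x = 0 \<or> t2 < x \<and> x < \<alpha> / 2"
proof -
  obtain s where s: "0 < s" "x = t_cross \<nu> \<alpha> s"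
    and left: "x = 0 \<or> (\<exists>\<epsilon>>0. \<forall>y\<in>{x - \<epsilon><..<x}. F_inf \<nu> s y > y / \<alpha>)"
    using assms unfolding is_LCP_def by blast
  consider "s2 < s" | "s = s2" | "s < s2" by linarith
  then show ?thesis
  proof cases
    case 1
    then show ?thesis
      using gap_neg_above t_cross_eq_0[of s] s by force
  next
    case 2
    have "t_cross \<nu> \<alpha> s2 = F_t \<nu> (- u2)"
      by (rule t_cross_eq) (use u2 gap_s2 gap_s2_neg in force)+
    then have "x = t2" using s(2) 2 by (simp only: t2[symmetric])
    then obtain \<epsilon> where \<epsilon>: "0 < \<epsilon>" "\<And>y. y \<in> {x - \<epsilon><..<x} \<Longrightarrow> F_inf \<nu> s y > y / \<alpha>"
      using left t2_pos by auto
    \<comment> \<open>A test point to the left of x, within distance \<epsilon> and still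
      positive.\<close>
    define y where "y = max (x / 2) (x - \<epsilon> / 2)"
    have y: "0 < y" "y < x" "x - \<epsilon> < y" using \<epsilon> \<open>x = t2\<close> t2_pos by (auto simp: y_def)
    have "x < 1" using t.F_less_1[of "- u2"] by (simp only: \<open>x = t2\<close> t2[symmetric])
    then obtain v where v: "y = F_t \<nu> (- v)" using F_t_cases[of y] y by auto
    have "u2 < v" using y by (simp add: v \<open>x = t2\<close> less_t2_iff)
    then have "gap s v < 0" using gap_s2_neg[of v] u2 2 by simp
    then have "F_inf \<nu> s y < y / \<alpha>" by (simp add: v F_inf_iff)
    then show ?thesis using \<epsilon>(2)[of y] y by simp
  next
    case 3
    obtain u where u: "0 \<le> u" "u \<le> u2" "gap s u = 0"
      using IVT'[of "gap s" 0 0 u2] gap_0[of s] gap_pos_below[OF 3] u2 continuous_gap by auto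
    have "u \<noteq> 0" "u \<noteq> u2" using u gap_0[of s] gap_pos_below[OF 3] by auto
    then have u': "0 < u" "u < u2" using u by auto
    have "x = F_t \<nu> (- u)"
      unfolding s(2) by (rule t_cross_eq) (use u cross_before(2)[OF s(1) u' u(3)] in force)+
    then show ?thesis
      using u' gap_zero_less[OF u(3) u'(1)] s(1) by (simp add: t2_less_iff)
  qed
qed

lemma LCP_set_eq: "LCP_set \<nu> \<alpha> = {0} \<union> {t2<..<\<alpha> / 2}"
proof (rule set_eqI)
  show "x \<in> LCP_set \<nu> \<alpha> \<longleftrightarrow> x \<in> {0} \<union> {t2<..<\<alpha> / 2}" for x
    unfolding LCP_set_def mem_Collect_eq Un_iff singleton_iff greaterThanLessThan_iff
    using LCP_cases[of x] is_LCP_0 is_LCP_cross[of x] by blast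
qed

text \<open>The limiting proportion of rejections is at least \<open>x\<close> iff \<open>S < threshold x\<close>.\<close>

definition threshold :: "real \<Rightarrow> real" where
  "threshold x = (if x \<le> t2 / \<alpha> then s2 else s_cross \<nu> \<alpha> (\<alpha> * x))"

text \<open>For levels x \<le> t2 / \<alpha> only the side of s2 matters, because the limit jumps
  over them. Above, the threshold is the scale whose crossing is \<alpha> x.\<close>

lemma threshold_cases:
  assumes "0 < x" "x < 1"
  obtains (plateau) "x \<le> t2 / \<alpha>" "threshold x = s2"
  | (curve) u where "0 < u" "u < u2" "\<alpha> * x = F_t \<nu> (- u)" "gap (threshold x) u = 0"
proof (cases "x \<le> t2 / \<alpha>")
  case True
  then show thesis using plateau by (simp add: threshold_def)
next
  case False
  have "0 < \<alpha> * x" using assms alpha by simp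
  moreover have "\<alpha> * x < \<alpha> * 1" using assms alpha by (intro mult_strict_left_mono) auto
  then have less: "\<alpha> * x < \<alpha>" by simp
  moreover have "\<alpha> * x < 1" using less alpha by linarith
  ultimately obtain u where u: "\<alpha> * x = F_t \<nu> (- u)" by (meson F_t_cases)
  have "F_t \<nu> (- u) < F_t \<nu> 0" using less alpha unfolding u t.F_0 by linarith
  then have "0 < u" by simp
  have "t2 < F_t \<nu> (- u)" using False alpha unfolding u[symmetric] by (simp add: field_simps)
  then have "u < u2" by (simp add: t2_less_iff)
  have "gap (threshold x) u = 0"
    using gap_s_cross[of u] \<open>0 < u\<close> less False unfolding threshold_def u by simp
  then show thesis using curve \<open>0 < u\<close> \<open>u < u2\<close> u by blast
qed

lemma gap_neg_above_threshold:
  assumes "0 < x" "x < 1" "0 < s" "threshold x < s" "0 \<le> v" "\<alpha> * x \<le> F_t \<nu> (- v)"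
  shows "gap s v < 0"
  using assms(1,2)
proof (cases rule: threshold_cases)
  case plateau
  then show ?thesis using assms by (intro gap_neg_above) auto
next
  case (curve u)
  let ?s = "threshold x"
  have "v \<le> u" using assms(6) unfolding curve(3) by simp
  show ?thesis
  proof (cases "v = 0")
    case False
    then have "0 < v" using assms by simp
    show ?thesis
    proof (cases "0 < ?s")
      case True
      have "gap s v < gap ?s v" using assms \<open>0 < v\<close> by (intro gap_strict_antimono)
      also have "\<dots> \<le> 0"
        using cross_before(2)[OF True curve(1,2,4), of v] curve(4) \<open>0 < v\<close> \<open>v \<le> u\<close>
        by (cases "v = u") auto
      finally show ?thesis .
    next
      case neg: False
      \<comment> \<open>The threshold is not positive when x \<ge> 1/2. A comparison with s = 0,
        where the normal term is the constant \<alpha> / 2, replaces the one with the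
        threshold.\<close>
      then have "\<alpha> / 2 \<le> F_t \<nu> (- u)" using gap_zero_less[OF curve(4,1)] by simp
      also have "\<dots> \<le> F_t \<nu> (- v)" using \<open>v \<le> u\<close> by simp
      finally have "gap 0 v \<le> 0" by (simp add: gap_def normal.F_0)
      then show ?thesis using gap_strict_antimono[of 0 s v] assms \<open>0 < v\<close> by simp
    qed
  qed (simp add: gap_0)
qed

text \<open>Levels t \<ge> \<alpha> x correspond to a compact interval of u, on which the negative
  gap stays away from 0. This margin absorbs the error of the empirical distribution; without a
  lower bound on t there is none, since the gap tends to 0 as u grows.\<close>

lemma gap_bound_above_threshold:
  assumes "0 < x" "x < 1" "0 < s" "threshold x < s"
  obtains \<eta> where "0 < \<eta>" "\<And>v. 0 \<le> v \<Longrightarrow> \<alpha> * x \<le> F_t \<nu> (- v) \<Longrightarrow> gap s v \<le> - \<eta>"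
proof -
  have x: "0 < \<alpha> * x" "\<alpha> * x < \<alpha>" using assms alpha by auto
  moreover have "\<alpha> * x < 1" using x alpha by linarith
  ultimately obtain u where u: "\<alpha> * x = F_t \<nu> (- u)" by (meson F_t_cases)
  have "F_t \<nu> (- u) < F_t \<nu> 0" using x alpha unfolding u t.F_0 by linarith
  then have "0 \<le> u" by simp
  then obtain w where w: "w \<in> {0..u}" "\<And>v. v \<in> {0..u} \<Longrightarrow> gap s v \<le> gap s w"
    using continuous_attains_sup[of "{0..u}" "gap s"] continuous_gap by auto
  show thesis
  proof (rule that[of "- gap s w"])
    show "0 < - gap s w"
      using gap_neg_above_threshold[OF assms, of w] w(1) by (simp add: u)
    show "gap s v \<le> - (- gap s w)" if "0 \<le> v" "\<alpha> * x \<le> F_t \<nu> (- v)" for v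
      using w(2)[of v] that by (simp add: u)
  qed
qed

text \<open>The witness is u2 on the plateau and the coordinate of \<alpha> x elsewhere: lowering s
  raises the gap from 0 at that point.\<close>

lemma gap_pos_below_threshold:
  assumes "0 < x" "x < 1" "0 < s" "s < threshold x"
  obtains v where "0 < v" "\<alpha> * x \<le> F_t \<nu> (- v)" "0 < gap s v"
  using assms(1,2)
proof (cases rule: threshold_cases)
  case plateau
  have "\<alpha> * x \<le> t2" using plateau alpha by (simp add: field_simps)
  then show thesis
    using that[of u2] u2 gap_pos_below[of s] plateau assms by (simp only: t2[symmetric])
next
  case (curve u)
  have "0 < gap s u" using gap_strict_antimono[of s "threshold x" u] curve assms by simp
  then show thesis using that[of u] curve by simp
qed

end

section \<open>The step-up procedure\<close>

lemma sorted_nth_le_iff: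
  fixes xs :: "'a::linorder list"
  assumes "sorted xs" "i < length xs"
  shows "xs ! i \<le> c \<longleftrightarrow> i < length (filter (\<lambda>x. x \<le> c) xs)"
proof -
  have card: "length (filter (\<lambda>x. x \<le> c) xs) = card {j. j < length xs \<and> xs ! j \<le> c}"
    by (rule length_filter_conv_card)
  have mono: "xs ! j \<le> xs ! k" if "j \<le> k" "k < length xs" for j k
    using assms(1) that by (rule sorted_nth_mono)
  show ?thesis
  proof
    assume "xs ! i \<le> c"
    then have "{..i} \<subseteq> {j. j < length xs \<and> xs ! j \<le> c}"
      using mono assms(2) by (auto intro: order_trans)
    then have "card {..i} \<le> card {j. j < length xs \<and> xs ! j \<le> c}"
      by (intro card_mono) auto
    then show "i < length (filter (\<lambda>x. x \<le> c) xs)" by (simp add: card)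
  next
    assume less: "i < length (filter (\<lambda>x. x \<le> c) xs)"
    show "xs ! i \<le> c"
    proof (rule ccontr)
      assume "\<not> xs ! i \<le> c"
      then have "j < i" if "j < length xs" "xs ! j \<le> c" for j
        using mono[of i j] that by (meson not_less order_trans)
      then have "{j. j < length xs \<and> xs ! j \<le> c} \<subseteq> {..<i}" by auto
      then have "card {j. j < length xs \<and> xs ! j \<le> c} \<le> card {..<i}"
        by (intro card_mono) auto
      then show False using less by (simp add: card)
    qed
  qed
qed

text \<open>Replaces order statistics by counts, so that from here on only the empirical
  distribution of the p-values matters.\<close>

lemma ord_stat_le_iff:
  assumes "1 \<le> i" "i \<le> n"
  shows "ord_stat p n i \<le> c \<longleftrightarrow> i \<le> card {j \<in> {..<n}. p j \<le> c}"
proof -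
  have "length (filter (\<lambda>x. x \<le> c) (sort (map p [0..<n])))
      = size (filter_mset (\<lambda>x. x \<le> c) (mset (sort (map p [0..<n]))))"
    by (metis mset_filter size_mset)
  also have "\<dots> = length (filter (\<lambda>x. x \<le> c) (map p [0..<n]))"
    by (metis mset_filter mset_sort size_mset)
  also have "\<dots> = card {j. j < n \<and> map p [0..<n] ! j \<le> c}"
    by (simp add: length_filter_conv_card del: nth_map)
  also have "{j. j < n \<and> map p [0..<n] ! j \<le> c} = {j \<in> {..<n}. p j \<le> c}" by auto
  finally show ?thesis
    unfolding ord_stat_def using assms by (subst sorted_nth_le_iff) auto
qed

text \<open>Some index i \<ge> k must be admissible, not k itself: a step-up procedure takes the
  largest admissible index.\<close>

lemma lsu_m_ge_iff:
  assumes "1 \<le> k"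
  shows "k \<le> lsu_m \<alpha> n p
    \<longleftrightarrow> (\<exists>i\<in>{k..n}. i \<le> card {j \<in> {..<n}. p j \<le> real i * \<alpha> / real n})"
proof -
  define A where "A = {i \<in> {1..n}. ord_stat p n i \<le> real i * \<alpha> / real n}"
  have m: "lsu_m \<alpha> n p = (if A = {} then 0 else Max A)"
    unfolding lsu_m_def A_def Let_def ..
  have "finite A" by (simp add: A_def)
  then have "k \<le> lsu_m \<alpha> n p \<longleftrightarrow> (\<exists>i\<in>A. k \<le> i)"
    using assms by (auto simp: m Max_ge_iff)
  also have "\<dots> \<longleftrightarrow> (\<exists>i\<in>{k..n}. i \<le> card {j \<in> {..<n}. p j \<le> real i * \<alpha> / real n})"
  proof -
    have "A = {i \<in> {1..n}. i \<le> card {j \<in> {..<n}. p j \<le> real i * \<alpha> / real n}}"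
      unfolding A_def by (intro Collect_cong conj_cong refl ord_stat_le_iff) auto
    then have "i \<in> A \<and> k \<le> i
        \<longleftrightarrow> i \<in> {k..n} \<and> i \<le> card {j \<in> {..<n}. p j \<le> real i * \<alpha> / real n}" for i
      using assms by auto
    then show ?thesis by (simp only: Bex_def)
  qed
  finally show ?thesis .
qed

lemma lsu_m_props:
  assumes "0 < lsu_m \<alpha> n p"
  shows "lsu_m \<alpha> n p \<le> n"
    "lsu_m \<alpha> n p \<le> card {j \<in> {..<n}. p j \<le> real (lsu_m \<alpha> n p) * \<alpha> / real n}"
proof -
  let ?m = "lsu_m \<alpha> n p"
  obtain i where i: "?m \<le> i" "i \<le> n" "i \<le> card {j \<in> {..<n}. p j \<le> real i * \<alpha> / real n}"
    using lsu_m_ge_iff[of ?m \<alpha> n p] assms by auto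
  then have "i \<le> ?m" using lsu_m_ge_iff[of i \<alpha> n p] assms by auto
  then have "i = ?m" using i by simp
  then show "?m \<le> n" "?m \<le> card {j \<in> {..<n}. p j \<le> real ?m * \<alpha> / real n}" using i by auto
qed

lemma lsu_m_le: "lsu_m \<alpha> n p \<le> n"
  using lsu_m_props(1)[of \<alpha> n p] by (cases "lsu_m \<alpha> n p = 0") auto

text \<open>Let c be the number of p-values up to the critical value of m. Then c \<ge> m, so the
  critical value of c is at least as large and c is itself admissible; maximality of m gives c \<le>
  m.\<close>

lemma card_lsu_rej:
  assumes "0 < \<alpha>"
  shows "card (lsu_rej \<alpha> n p) = lsu_m \<alpha> n p"
proof (cases "lsu_m \<alpha> n p = 0")
  case False
  let ?m = "lsu_m \<alpha> n p"
  let ?c = "card {j \<in> {..<n}. p j \<le> real ?m * \<alpha> / real n}"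
  have "0 < n" using lsu_m_le[of \<alpha> n p] False by simp
  have "?m \<le> ?c" using lsu_m_props[of \<alpha> n p] False by simp
  have "?c \<le> card {..<n}" by (intro card_mono) auto
  then have "?c \<le> n" by simp
  have "real ?m * \<alpha> / real n \<le> real ?c * \<alpha> / real n"
    using \<open>?m \<le> ?c\<close> assms by (intro divide_right_mono mult_right_mono) auto
  then have "?c \<le> card {j \<in> {..<n}. p j \<le> real ?c * \<alpha> / real n}"
    by (intro card_mono) (auto intro: order_trans)
  moreover have "1 \<le> ?c" using \<open>?m \<le> ?c\<close> False by linarith
  ultimately have "?c \<le> ?m"
    unfolding lsu_m_ge_iff[OF \<open>1 \<le> ?c\<close>] using \<open>?c \<le> n\<close> by (intro bexI[of _ ?c]) auto
  moreover have "lsu_rej \<alpha> n p = {j \<in> {..<n}. p j \<le> real ?m * \<alpha> / real n}"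
    by (simp only: lsu_rej_def if_not_P[OF False])
  ultimately show ?thesis using \<open>?m \<le> ?c\<close> by (simp only:)
qed (simp add: lsu_rej_def)

text \<open>A p-value that is not positive makes the index 1 admissible. It serves the false
  hypotheses, whose p-values are 0.\<close>

lemma lsu_rej_zero:
  assumes "0 < \<alpha>" "j < n" "p j \<le> 0"
  shows "j \<in> lsu_rej \<alpha> n p"
proof -
  have pos: "p j \<le> real i * \<alpha> / real n" for i
    by (rule order_trans[OF assms(3)]) (use assms(1) in simp)
  have "card {j} \<le> card {j \<in> {..<n}. p j \<le> real 1 * \<alpha> / real n}"
    using assms(2) pos[of 1] by (intro card_mono) auto
  then have "1 \<le> card {j \<in> {..<n}. p j \<le> real 1 * \<alpha> / real n}" by simp
  then have "1 \<le> lsu_m \<alpha> n p"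
    unfolding lsu_m_ge_iff[OF order_refl] using assms(2) by (intro bexI[of _ 1]) auto
  then show ?thesis
    using assms(2) pos[of "lsu_m \<alpha> n p"] by (simp add: lsu_rej_def)
qed

section \<open>The step-up index when the empirical distribution is close to its limit\<close>

context tangent_point
begin

text \<open>A deterministic condition, uniform in u, so that the step-up bounds below involve no
  probability. The value n Phi (- s u) is the number of p-values up to F_t (- u) expected under S =
  s if all hypotheses are true.\<close>

definition ecdf_close :: "nat \<Rightarrow> (nat \<Rightarrow> real) \<Rightarrow> real \<Rightarrow> real \<Rightarrow> bool" where
  "ecdf_close n p s \<delta> \<longleftrightarrow> (\<forall>u. \<bar>real (card {j \<in> {..<n}. p j \<le> F_t \<nu> (- u)}) - real n * Phi (- (s * u))\<bar>
     \<le> \<delta> * real n)"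

text \<open>The index m is admissible, so at t = m \<alpha> / n the empirical distribution reaches t
  / \<alpha>. If t \<ge> \<alpha> x, the limit stays below t / \<alpha> by \<eta> / \<alpha>, and an
  error of half that size is too small. One \<delta> serves all larger scales because Phi (- s v)
  decreases in s.\<close>

lemma lsu_m_less:
  assumes "0 < x" "x < 1" "0 < s" "threshold x < s"
  obtains \<delta> where "0 < \<delta>"
    "\<And>n p s'. 0 < n \<Longrightarrow> s \<le> s' \<Longrightarrow> ecdf_close n p s' \<delta> \<Longrightarrow> real (lsu_m \<alpha> n p) < real n * x"
proof -
  obtain \<eta> where \<eta>: "0 < \<eta>" "\<And>v. 0 \<le> v \<Longrightarrow> \<alpha> * x \<le> F_t \<nu> (- v) \<Longrightarrow> gap s v \<le> - \<eta>"
    using gap_bound_above_threshold[OF assms] by blast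
  show thesis
  proof (rule that[of "\<eta> / (2 * \<alpha>)"])
    fix n :: nat and p s'
    assume n: "0 < n" and s': "s \<le> s'" and close: "ecdf_close n p s' (\<eta> / (2 * \<alpha>))"
    show "real (lsu_m \<alpha> n p) < real n * x"
    proof (rule ccontr)
      let ?m = "lsu_m \<alpha> n p"
      define t where "t = real ?m * \<alpha> / real n"
      assume "\<not> real ?m < real n * x"
      then have ge: "real n * x \<le> real ?m" by simp
      have "0 < real n * x" using n assms by simp
      then have "0 < ?m" using ge by (cases ?m) auto
      have "\<alpha> * x \<le> t" using ge n alpha by (simp add: t_def field_simps)
      have "t \<le> \<alpha>" using lsu_m_le[of \<alpha> n p] n alpha by (simp add: t_def field_simps)
      have "0 < t" using \<open>0 < ?m\<close> n alpha by (simp add: t_def)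
      then obtain v where v: "t = F_t \<nu> (- v)" using F_t_cases[of t] \<open>t \<le> \<alpha>\<close> alpha by auto
      have "F_t \<nu> (- v) \<le> F_t \<nu> 0" using \<open>t \<le> \<alpha>\<close> alpha unfolding v[symmetric] t.F_0 by simp
      then have "0 \<le> v" by simp
      have "s * v \<le> s' * v" using s' \<open>0 \<le> v\<close> by (rule mult_right_mono)
      then have "Phi (- (s' * v)) \<le> Phi (- (s * v))" by simp
      also have "\<dots> = (gap s v + t) / \<alpha>" using alpha by (simp add: gap_def v)
      also have "\<dots> \<le> (- \<eta> + t) / \<alpha>"
        using \<eta>(2)[OF \<open>0 \<le> v\<close>] \<open>\<alpha> * x \<le> t\<close> v alpha by (intro divide_right_mono) auto
      finally have "real n * Phi (- (s' * v)) \<le> real n * ((- \<eta> + t) / \<alpha>)"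
        by (rule mult_left_mono) simp
      also have "\<dots> = real ?m - real n * (\<eta> / \<alpha>)"
        using n alpha by (simp add: t_def field_simps)
      finally have 1: "real n * Phi (- (s' * v)) \<le> real ?m - real n * (\<eta> / \<alpha>)" .
      have "real ?m \<le> real (card {j \<in> {..<n}. p j \<le> t})"
        using lsu_m_props(2)[OF \<open>0 < ?m\<close>] by (simp add: t_def)
      also have "\<dots> \<le> real n * Phi (- (s' * v)) + \<eta> / (2 * \<alpha>) * real n"
      proof -
        have "\<bar>real (card {j \<in> {..<n}. p j \<le> F_t \<nu> (- v)}) - real n * Phi (- (s' * v))\<bar>
            \<le> \<eta> / (2 * \<alpha>) * real n"
          using close unfolding ecdf_close_def by blast
        then show ?thesis unfolding v by linarith
      qed
      finally have "real n * (\<eta> / \<alpha>) \<le> \<eta> / (2 * \<alpha>) * real n" using 1 by linarith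
      then show False using n alpha \<eta>(1) by (simp add: field_simps)
    qed
  qed (use \<eta> alpha in auto)
qed

lemma lsu_m_ge:
  assumes "0 < x" "x < 1" "0 < s" "s < threshold x"
  obtains \<delta> N where "0 < \<delta>"
    "\<And>n p s'. N \<le> n \<Longrightarrow> s' \<le> s \<Longrightarrow> ecdf_close n p s' \<delta> \<Longrightarrow> real n * x \<le> real (lsu_m \<alpha> n p)"
proof -
  obtain v where v: "0 < v" "\<alpha> * x \<le> F_t \<nu> (- v)" "0 < gap s v"
    using gap_pos_below_threshold[OF assms] by blast
  \<comment> \<open>Half of the surplus of Phi (- s v) over t / \<alpha>: one half pays for the
    empirical error, the other, once n \<delta> > 1, for rounding k up.\<close>
  define \<delta> where "\<delta> = gap s v / (2 * \<alpha>)"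
  have \<delta>: "0 < \<delta>" using v alpha by (simp add: \<delta>_def)
  obtain N :: nat where N: "1 / \<delta> < real N" using reals_Archimedean2 by blast
  show thesis
  proof (rule that[of \<delta> N])
    fix n p s' assume n: "N \<le> n" and s': "s' \<le> s" and close: "ecdf_close n p s' \<delta>"
    have "1 / \<delta> < real n" using n N by linarith
    then have "1 < \<delta> * real n" using \<delta> by (simp add: field_simps)
    then have "0 < n" by (cases n) auto
    let ?t = "F_t \<nu> (- v)"
    \<comment> \<open>The least index whose critical value k \<alpha> / n reaches the level of
      v.\<close>
    define k where "k = nat \<lceil>real n * (?t / \<alpha>)\<rceil>"
    have t: "0 < ?t" by (rule t.F_pos)
    have "0 < real n * (?t / \<alpha>)" using t alpha \<open>0 < n\<close> by simp
    then have k: "real n * (?t / \<alpha>) \<le> real k" "real k < real n * (?t / \<alpha>) + 1" "1 \<le> k"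
      unfolding k_def by linarith+
    have "s' * v \<le> s * v" using s' v by (intro mult_right_mono) auto
    then have "Phi (- (s * v)) \<le> Phi (- (s' * v))" by simp
    moreover have "Phi (- (s * v)) = ?t / \<alpha> + 2 * \<delta>"
      using alpha by (simp add: gap_def \<delta>_def field_simps)
    ultimately have "real n * (?t / \<alpha> + 2 * \<delta>) \<le> real n * Phi (- (s' * v))"
      by (intro mult_left_mono) auto
    also have "\<dots> \<le> real (card {j \<in> {..<n}. p j \<le> ?t}) + \<delta> * real n"
    proof -
      have "\<bar>real (card {j \<in> {..<n}. p j \<le> ?t}) - real n * Phi (- (s' * v))\<bar> \<le> \<delta> * real n"
        using close unfolding ecdf_close_def by blast
      then show ?thesis by linarith
    qed
    finally have "real k \<le> real (card {j \<in> {..<n}. p j \<le> ?t})"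
      using k(2) \<open>1 < \<delta> * real n\<close> by (simp add: algebra_simps)
    moreover have "?t \<le> real k * \<alpha> / real n"
      using k(1) alpha \<open>0 < n\<close> by (simp add: field_simps)
    then have "card {j \<in> {..<n}. p j \<le> ?t} \<le> card {j \<in> {..<n}. p j \<le> real k * \<alpha> / real n}"
      by (intro card_mono) (auto intro: order_trans)
    ultimately have *: "k \<le> card {j \<in> {..<n}. p j \<le> real k * \<alpha> / real n}" by linarith
    have "\<dots> \<le> card {..<n}" by (intro card_mono) auto
    with * have "k \<le> n" by simp
    then have "k \<le> lsu_m \<alpha> n p" using lsu_m_ge_iff[OF k(3)] * by auto
    moreover have "real n * x \<le> real n * (?t / \<alpha>)"
      using v(2) alpha by (intro mult_left_mono) (simp_all add: field_simps)
    ultimately show "real n * x \<le> real (lsu_m \<alpha> n p)" using k(1) by linarith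
  qed (rule \<delta>)
qed

end

section \<open>Auxiliary facts from analysis and probability\<close>

text \<open>The layer-cake formula by Tonelli. It is stated for the gauge integral, the one in the
  EER limit.\<close>

lemma (in prob_space) expectation_eq_integral_tail:
  fixes Y :: "'a \<Rightarrow> real"
  assumes [measurable]: "Y \<in> borel_measurable M" and Y: "\<And>\<omega>. \<omega> \<in> space M \<Longrightarrow> 0 \<le> Y \<omega> \<and> Y \<omega> \<le> 1"
  shows "((\<lambda>x. prob {\<omega> \<in> space M. x \<le> Y \<omega>}) has_integral expectation Y) {0..1}"
proof -
  let ?P = "\<lambda>x. prob {\<omega> \<in> space M. x \<le> Y \<omega>}"
  interpret pair_sigma_finite lborel M
    by (simp add: pair_sigma_finite_def lborel.sigma_finite_measure_axioms sigma_finite_measure_axioms)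
  have "antimono ?P"
    by (intro antimonoI finite_measure_mono) auto
  then have "mono (\<lambda>x. - ?P x)" by (auto simp: mono_def antimono_def)
  then have "(\<lambda>x. - (- ?P x)) \<in> borel_measurable borel"
    by (intro borel_measurable_uminus borel_measurable_mono)
  then have meas: "?P \<in> borel_measurable borel" by simp
  have "integrable M Y"
    by (rule integrable_const_bound[of _ 1]) (use Y in auto)
  then have "ennreal (expectation Y) = (\<integral>\<^sup>+\<omega>. ennreal (Y \<omega>) \<partial>M)"
    using Y by (intro nn_integral_eq_integral[symmetric]) auto
  also have "\<dots> = (\<integral>\<^sup>+\<omega>. (\<integral>\<^sup>+x. indicator {0..Y \<omega>} x \<partial>lborel) \<partial>M)"
    using Y by (intro nn_integral_cong) simp
  also have "\<dots> = (\<integral>\<^sup>+\<omega>. (\<integral>\<^sup>+x. indicator {z \<in> space (lborel \<Otimes>\<^sub>M M). 0 \<le> fst z \<and> fst z \<le> 1 \<and> fst z \<le> Y (snd z)} (x, \<omega>) \<partial>lborel) \<partial>M)"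
    using Y by (intro nn_integral_cong)
      (auto simp: space_pair_measure dest: order_trans split: split_indicator)
  also have "\<dots> = (\<integral>\<^sup>+x. (\<integral>\<^sup>+\<omega>. indicator {z \<in> space (lborel \<Otimes>\<^sub>M M). 0 \<le> fst z \<and> fst z \<le> 1 \<and> fst z \<le> Y (snd z)} (x, \<omega>) \<partial>M) \<partial>lborel)"
    by (rule Fubini') measurable
  also have "\<dots> = (\<integral>\<^sup>+x. ennreal (?P x * indicator {0..1} x) \<partial>lborel)"
  proof (intro nn_integral_cong)
    fix x :: real
    have "(\<integral>\<^sup>+\<omega>. indicator {z \<in> space (lborel \<Otimes>\<^sub>M M). 0 \<le> fst z \<and> fst z \<le> 1 \<and> fst z \<le> Y (snd z)} (x, \<omega>) \<partial>M)
        = (\<integral>\<^sup>+\<omega>. indicator {0..1} x * indicator {\<omega> \<in> space M. x \<le> Y \<omega>} \<omega> \<partial>M)"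
      by (intro nn_integral_cong) (auto simp: space_pair_measure split: split_indicator)
    also have "\<dots> = indicator {0..1} x * emeasure M {\<omega> \<in> space M. x \<le> Y \<omega>}"
      by (subst nn_integral_cmult) auto
    also have "\<dots> = ennreal (?P x * indicator {0..1} x)"
      by (auto simp: emeasure_eq_measure split: split_indicator)
    finally show "(\<integral>\<^sup>+\<omega>. indicator {z \<in> space (lborel \<Otimes>\<^sub>M M). 0 \<le> fst z \<and> fst z \<le> 1 \<and> fst z \<le> Y (snd z)} (x, \<omega>) \<partial>M)
        = ennreal (?P x * indicator {0..1} x)" .
  qed
  finally have "(\<integral>\<^sup>+x. ennreal (?P x * indicator {0..1} x) \<partial>lborel) = ennreal (expectation Y)" ..
  then have "((\<lambda>x. ?P x * indicator {0..1} x) has_integral expectation Y) UNIV"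
    using meas Y by (intro nn_integral_has_integral) (auto intro!: integral_nonneg_AE)
  moreover have "(\<lambda>x. ?P x * indicator {0..1} x) = (\<lambda>x. if x \<in> {0..1} then ?P x else 0)"
    by (auto split: split_indicator)
  ultimately show ?thesis
    by (simp only: has_integral_restrict_UNIV)
qed

text \<open>A grid of normal quantiles controls the deviation of any decreasing function from the
  normal tail function, as in the proof of the Glivenko--Cantelli theorem.\<close>

lemma normal_grid:
  fixes \<eta> :: real
  assumes "0 < \<eta>"
  obtains Z :: "real set" where "finite Z"
    "\<And>g z. antimono g \<Longrightarrow> (\<And>z. 0 \<le> g z \<and> g z \<le> 1) \<Longrightarrow> (\<And>z. z \<in> Z \<Longrightarrow> \<bar>g z - Phi (- z)\<bar> \<le> \<eta>) \<Longrightarrow>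
       \<bar>g z - Phi (- z)\<bar> \<le> 2 * \<eta>"
proof -
  obtain K :: nat where K: "1 / \<eta> < real K" using reals_Archimedean2 by blast
  have "0 < 1 / \<eta>" using assms by simp
  then have "0 < real K" using K by linarith
  then have K': "0 < K" "1 / real K \<le> \<eta>" using K assms by (auto simp: field_simps)
  have "\<exists>z. Phi (- z) = real j / real K" if "1 \<le> j" "j < K" for j
  proof -
    have "0 < real j / real K" "real j / real K < 1" using that by simp_all
    then obtain x where "Phi x = real j / real K" by (rule normal.F_surj)
    then show ?thesis by (intro exI[of _ "- x"]) simp
  qed
  then have "\<exists>q. \<forall>j. 1 \<le> j \<and> j < K \<longrightarrow> Phi (- q j) = real j / real K"
    by (intro choice allI) blast
  then obtain q where q: "\<And>j. 1 \<le> j \<Longrightarrow> j < K \<Longrightarrow> Phi (- q j) = real j / real K"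
    by blast
  show thesis
  proof (rule that[of "q ` {1..<K}"])
    fix g :: "real \<Rightarrow> real" and z
    assume g: "antimono g" "\<And>z. 0 \<le> g z \<and> g z \<le> 1"
      and close: "\<And>z. z \<in> q ` {1..<K} \<Longrightarrow> \<bar>g z - Phi (- z)\<bar> \<le> \<eta>"
    define p where "p = Phi (- z)"
    have p: "0 < p" "p < 1" unfolding p_def by (rule normal.F_pos normal.F_less_1)+
    \<comment> \<open>The grid cell of p. Its end points are the levels of q j and q (j + 1); in the
      first and last cell the bounds 0 \<le> g \<le> 1 replace the missing grid point.\<close>
    define j where "j = nat \<lfloor>p * real K\<rfloor>"
    have j: "real j \<le> p * real K" "p * real K < real j + 1"
      using p by (simp_all add: j_def)
    have j1: "real j / real K \<le> p" "p < (real j + 1) / real K"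
      using j K' by (simp_all add: field_simps)
    have "real j < real K" using j(1) mult_strict_right_mono[OF p(2), of "real K"] K'(1) by linarith
    then have "j < K" by simp
    have "p - 2 * \<eta> \<le> g z"
    proof (cases "j = 0")
      case True
      then have "p < \<eta>" using j1(2) K' by simp
      then show ?thesis using g(2)[of z] assms by linarith
    next
      case False
      then have qj: "Phi (- q j) = real j / real K" using q \<open>j < K\<close> by simp
      then have "Phi (- q j) \<le> Phi (- z)" using j1(1) by (simp add: p_def)
      then have "z \<le> q j" by simp
      then have "g (q j) \<le> g z" using g(1) by (rule antimonoD[rotated])
      moreover have "\<bar>g (q j) - real j / real K\<bar> \<le> \<eta>"
        using close[of "q j"] False \<open>j < K\<close> qj by auto
      moreover have "p < real j / real K + 1 / real K" using j1(2) by (simp add: add_divide_distrib)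
      ultimately show ?thesis using K'(2) by linarith
    qed
    moreover have "g z \<le> p + 2 * \<eta>"
    proof (cases "j + 1 = K")
      case True
      then have "(real j + 1) / real K = 1" using K' by simp
      then have "1 \<le> p + 1 / real K" using j1(1) by (simp add: add_divide_distrib)
      then show ?thesis using g(2)[of z] K'(2) assms by linarith
    next
      case False
      let ?q = "q (j + 1)"
      have "j + 1 < K" using False \<open>j < K\<close> by simp
      then have qj: "Phi (- ?q) = real (j + 1) / real K" by (intro q) auto
      then have "Phi (- z) \<le> Phi (- ?q)" using j1(2) by (simp add: p_def add.commute)
      then have "?q \<le> z" by simp
      then have "g z \<le> g ?q" using g(1) by (rule antimonoD[rotated])
      moreover have "?q \<in> q ` {1..<K}" using \<open>j + 1 < K\<close> by (intro imageI) simp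
      then have "\<bar>g ?q - real (j + 1) / real K\<bar> \<le> \<eta>" using close[of ?q] unfolding qj by blast
      moreover have "real (j + 1) / real K \<le> p + 1 / real K"
        using j1(1) by (simp add: add_divide_distrib)
      ultimately show ?thesis using K'(2) by linarith
    qed
    ultimately show "\<bar>g z - Phi (- z)\<bar> \<le> 2 * \<eta>" unfolding p_def by linarith
  qed simp
qed

text \<open>The tail contains an interval of length 1, on which the density is smallest at the far
  end. This gives a polynomial lower bound without asymptotics of \<open>F_t\<close>.\<close>

lemma t_tail_ge:
  assumes "0 < \<nu>" "0 \<le> u"
  shows "t_density \<nu> (u + 1) \<le> F_t \<nu> (- u)"
proof -
  interpret t: symmetric_density "t_density \<nu>" "F_t \<nu>"
    using assms(1) by (rule symmetric_density_t)
  obtain z where z: "- u - 1 < z" "z < - u" "F_t \<nu> (- u) - F_t \<nu> (- u - 1) = (- u - (- u - 1)) * t_density \<nu> z"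
    using MVT2[of "- u - 1" "- u" "F_t \<nu>" "t_density \<nu>"] t.DERIV_F by auto
  have "\<bar>z\<bar> \<le> \<bar>u + 1\<bar>" using z assms by auto
  then have "z\<^sup>2 \<le> (u + 1)\<^sup>2" by (simp only: abs_le_square_iff)
  then have "1 + z\<^sup>2 / \<nu> \<le> 1 + (u + 1)\<^sup>2 / \<nu>" using assms by (simp add: divide_right_mono)
  moreover have "0 < 1 + z\<^sup>2 / \<nu>" using assms by (simp add: add_pos_nonneg)
  ultimately have "(1 + (u + 1)\<^sup>2 / \<nu>) powr (- (\<nu> + 1) / 2) \<le> (1 + z\<^sup>2 / \<nu>) powr (- (\<nu> + 1) / 2)"
    using assms by (intro powr_mono2') auto
  moreover have "0 \<le> Gamma ((\<nu> + 1) / 2) / (sqrt (\<nu> * pi) * Gamma (\<nu> / 2))"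
    using assms Gamma_real_pos[of "(\<nu> + 1) / 2"] Gamma_real_pos[of "\<nu> / 2"]
    by (intro divide_nonneg_nonneg mult_nonneg_nonneg) auto
  ultimately have "t_density \<nu> (u + 1) \<le> t_density \<nu> z"
    unfolding t_density_def by (rule mult_left_mono)
  then show ?thesis using z(3) t.F_pos[of "- u - 1"] by simp
qed

text \<open>A p-value computed with \<open>S = s\<close> has an integrable reciprocal.\<close>

lemma nn_integral_inverse_p_tail:
  assumes "0 < \<nu>" "0 < s" "0 < \<epsilon>"
  obtains A where "0 < A" "(\<integral>\<^sup>+x. ennreal (std_normal_density x) * ennreal (indicator {A..} x / F_t \<nu> (- (x / s))) \<partial>lborel) \<le> ennreal \<epsilon>"
proof -
  interpret t: symmetric_density "t_density \<nu>" "F_t \<nu>"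
    using assms(1) by (rule symmetric_density_t)
  define c where "c = Gamma ((\<nu> + 1) / 2) / (sqrt (\<nu> * pi) * Gamma (\<nu> / 2))"
  define k where "k = (\<nu> + 1) / 2"
  have c: "0 < c" "0 < k"
    using assms Gamma_real_pos[of "(\<nu> + 1) / 2"] Gamma_real_pos[of "\<nu> / 2"] by (simp_all add: c_def k_def)
  have k: "- (\<nu> + 1) / 2 = - k" by (simp only: k_def minus_divide_left)
  have t: "t_density \<nu> u = c * (1 + u\<^sup>2 / \<nu>) powr (- k)" for u
    unfolding t_density_def c_def k ..
  \<comment> \<open>The normal density is eventually smaller than the polynomial tail bound even
    after a factor exp (- x) is put in; that factor is what remains to be integrated.\<close>
  have "eventually (\<lambda>x. 1 / sqrt (2 * pi) * exp (- x\<^sup>2 / 2)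
      \<le> exp (- x) * (c * (1 + (x / s + 1)\<^sup>2 / \<nu>) powr (- k))) at_top"
    using c assms by real_asymp
  moreover have "eventually (\<lambda>x. exp (- x) \<le> \<epsilon>) at_top"
    using assms(3) by real_asymp
  ultimately have "eventually (\<lambda>x. (1 / sqrt (2 * pi) * exp (- x\<^sup>2 / 2)
      \<le> exp (- x) * (c * (1 + (x / s + 1)\<^sup>2 / \<nu>) powr (- k))) \<and> exp (- x) \<le> \<epsilon> \<and> 0 < x) at_top"
    using eventually_gt_at_top[of "0::real"] by eventually_elim auto
  then obtain A where A: "\<And>x. A \<le> x \<Longrightarrow> 1 / sqrt (2 * pi) * exp (- x\<^sup>2 / 2)
      \<le> exp (- x) * (c * (1 + (x / s + 1)\<^sup>2 / \<nu>) powr (- k))" "exp (- A) \<le> \<epsilon>" "0 < A"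
    unfolding eventually_at_top_linorder by (meson order_refl)
  have le: "std_normal_density x / F_t \<nu> (- (x / s)) \<le> exp (- x)" if "A \<le> x" for x
  proof -
    have "std_normal_density x \<le> exp (- x) * t_density \<nu> (x / s + 1)"
      using A(1)[OF that] unfolding t std_normal_density_def .
    also have "\<dots> \<le> exp (- x) * F_t \<nu> (- (x / s))"
      using A(3) that assms by (intro mult_left_mono t_tail_ge) auto
    finally show ?thesis using t.F_pos[of "- (x / s)"] by (simp add: field_simps)
  qed
  have "(\<integral>\<^sup>+x. ennreal (std_normal_density x) * ennreal (indicator {A..} x / F_t \<nu> (- (x / s))) \<partial>lborel)
      \<le> (\<integral>\<^sup>+x. ennreal (exp (- x)) * indicator {A..} x \<partial>lborel)"
    using le by (intro nn_integral_mono)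
      (auto simp: ennreal_mult'[symmetric] split: split_indicator intro!: ennreal_leI)
  also have "\<dots> = ennreal (0 - (- exp (- A)))"
  proof (rule nn_integral_FTC_atLeast)
    show "((\<lambda>x. - exp (- x)) has_real_derivative exp (- x)) (at x)" for x :: real
      by (auto intro!: derivative_eq_intros)
    show "((\<lambda>x. - exp (- x :: real)) \<longlongrightarrow> 0) at_top" by real_asymp
  qed auto
  also have "\<dots> \<le> ennreal \<epsilon>" using A(2) by (intro ennreal_leI) simp
  finally show thesis using that A(3) by blast
qed

section \<open>The exchangeable t model\<close>

locale t_model = tangent_point \<alpha> \<nu> t2 + prob_space M
  for \<alpha> \<nu> t2 :: real and M :: "'a measure" +
  fixes n :: nat and T :: "nat set" and X :: "nat \<Rightarrow> 'a \<Rightarrow> real" and S :: "'a \<Rightarrow> real"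
  assumes T_sub: "T \<subseteq> {..<n}"
    and X_distr: "\<And>i. i \<in> T \<Longrightarrow> distributed M lborel (X i) (\<lambda>x. ennreal (std_normal_density x))"
    and S_pos: "\<And>\<omega>. \<omega> \<in> space M \<Longrightarrow> 0 < S \<omega>"
    and S_distr: "distributed M lborel (\<lambda>\<omega>. \<nu> * (S \<omega>)\<^sup>2) (\<lambda>x. ennreal (chisq_density \<nu> x))"
    and indep: "indep_vars (\<lambda>_. borel) (\<lambda>j. case j of None \<Rightarrow> S | Some i \<Rightarrow> X i) (insert None (Some ` T))"
begin

lemma finite_T [simp, intro]: "finite T"
  using T_sub finite_subset by blast

lemma card_T_le: "card T \<le> n"
  using card_mono[OF _ T_sub] by simp

lemma measurable_X [measurable (raw)]: "i \<in> T \<Longrightarrow> X i \<in> borel_measurable M"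
  using distributed_measurable[OF X_distr] by simp

lemma measurable_S [measurable]: "S \<in> borel_measurable M"
  using indep unfolding indep_vars_def by auto

abbreviation p :: "'a \<Rightarrow> nat \<Rightarrow> real" where "p \<equiv> pval \<nu> T X S"
abbreviation R :: "'a \<Rightarrow> nat" where "R \<equiv> R_count \<nu> \<alpha> n T X S"
abbreviation V :: "'a \<Rightarrow> nat" where "V \<equiv> V_count \<nu> \<alpha> n T X S"

lemma measurable_p [measurable]: "(\<lambda>\<omega>. p \<omega> j) \<in> borel_measurable M"
proof (cases "j \<in> T")
  case True
  then have "(\<lambda>\<omega>. F_t \<nu> (X j \<omega> / S \<omega>)) \<in> borel_measurable M"
    by (intro measurable_compose[OF _ t.borel_measurable_F] borel_measurable_divide measurable_X measurable_S)
  then show ?thesis using True by (simp add: pval_def)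
qed (simp add: pval_def)

lemma R_eq: "R \<omega> = lsu_m \<alpha> n (p \<omega>)"
  using alpha by (simp add: R_count_def card_lsu_rej)

lemma R_le: "R \<omega> \<le> n"
  by (simp add: R_eq lsu_m_le)

text \<open>All false hypotheses are rejected, so R and V differ by a constant. Limits for V
  therefore follow from those for R.\<close>

lemma R_eq_V: "R \<omega> = V \<omega> + (n - card T)"
proof -
  let ?J = "lsu_rej \<alpha> n (p \<omega>)"
  have "j \<in> ?J" if "j < n" "j \<notin> T" for j
    using that alpha by (intro lsu_rej_zero) (simp_all add: pval_def)
  moreover have "?J \<subseteq> {..<n}" by (auto simp: lsu_rej_def)
  ultimately have *: "?J - T = {..<n} - T" by auto
  have "R \<omega> = card (?J \<inter> T) + card (?J - T)"
    unfolding R_count_def using \<open>?J \<subseteq> {..<n}\<close> finite_subset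
    by (subst card_Un_disjoint[symmetric]) (auto intro!: arg_cong[where f = card])
  also have "card (?J - T) = n - card T"
    unfolding * using T_sub by (simp add: card_Diff_subset)
  finally show ?thesis by (simp add: V_count_def)
qed

text \<open>Through counts the event becomes a finite union of conditions on sums of indicators of
  the p-values.\<close>

lemma measurable_R_ge [measurable]: "{\<omega> \<in> space M. k \<le> R \<omega>} \<in> sets M"
proof (cases "1 \<le> k")
  case True
  have card: "real (card {j \<in> {..<n}. p \<omega> j \<le> c}) = (\<Sum>j<n. indicator {..c} (p \<omega> j))" for \<omega> c
    by (simp add: indicator_def sum.If_cases Int_def)
  have "{\<omega> \<in> space M. k \<le> R \<omega>} = {\<omega> \<in> space M.
      \<exists>i\<in>{k..n}. real i \<le> (\<Sum>j<n. indicator {..real i * \<alpha> / real n} (p \<omega> j))}"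
    unfolding R_eq lsu_m_ge_iff[OF True] card[symmetric] of_nat_le_iff ..
  also have "\<dots> \<in> sets M" by measurable
  finally show ?thesis .
qed (simp add: not_le)

lemma measurable_R [measurable]: "(\<lambda>\<omega>. real (R \<omega>)) \<in> borel_measurable M"
proof -
  have "real (R \<omega>) = (\<Sum>k\<in>{1..n}. indicator {\<omega> \<in> space M. k \<le> R \<omega>} \<omega>)" if "\<omega> \<in> space M" for \<omega>
  proof -
    have "(\<Sum>k\<in>{1..n}. indicator {\<omega> \<in> space M. k \<le> R \<omega>} \<omega> :: real) = (\<Sum>k\<in>{1..R \<omega>}. 1)"
      using that R_le[of \<omega>] by (intro sum.mono_neutral_cong_right) (auto simp: indicator_def)
    then show ?thesis by simp
  qed
  then show ?thesis
    by (subst measurable_cong) (assumption, measurable)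
qed

lemma V_eq: "real (V \<omega>) = real (R \<omega>) - real (n - card T)"
  by (simp add: R_eq_V)

lemma measurable_V [measurable]: "(\<lambda>\<omega>. real (V \<omega>)) \<in> borel_measurable M"
  unfolding V_eq by measurable

lemma chisq_density_nonneg: "0 \<le> chisq_density \<nu> x"
  using nu Gamma_real_pos[of "\<nu> / 2"] by (simp add: chisq_density_def)

lemma prob_S_le: "prob {\<omega> \<in> space M. S \<omega> \<le> s} = F_chi \<nu> (sqrt \<nu> * s)"
proof (cases "0 < s")
  case True
  have "{\<omega> \<in> space M. S \<omega> \<le> s} = (\<lambda>\<omega>. \<nu> * (S \<omega>)\<^sup>2) -` {0..(sqrt \<nu> * s)\<^sup>2} \<inter> space M"
  proof -
    have "S \<omega> \<le> s \<longleftrightarrow> 0 \<le> \<nu> * (S \<omega>)\<^sup>2 \<and> \<nu> * (S \<omega>)\<^sup>2 \<le> (sqrt \<nu> * s)\<^sup>2" if "\<omega> \<in> space M" for \<omega>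
      using S_pos[OF that] True nu abs_le_square_iff[of "S \<omega>" s] by (simp add: power_mult_distrib)
    then show ?thesis by auto
  qed
  moreover have [measurable]: "chisq_density \<nu> \<in> borel_measurable borel"
    using distributed_real_measurable[OF _ S_distr] chisq_density_nonneg by simp
  ultimately have "emeasure M {\<omega> \<in> space M. S \<omega> \<le> s}
      = (\<integral>\<^sup>+x. ennreal (chisq_density \<nu> x) * indicator {0..(sqrt \<nu> * s)\<^sup>2} x \<partial>lborel)"
    using distributed_emeasure[OF S_distr, of "{0..(sqrt \<nu> * s)\<^sup>2}"] by simp
  also have "\<dots> = (\<integral>\<^sup>+x. ennreal (indicator {0..(sqrt \<nu> * s)\<^sup>2} x * chisq_density \<nu> x) \<partial>lborel)"
    by (intro nn_integral_cong) (auto split: split_indicator)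
  finally have "prob {\<omega> \<in> space M. S \<omega> \<le> s}
      = (\<integral>x. indicator {0..(sqrt \<nu> * s)\<^sup>2} x * chisq_density \<nu> x \<partial>lborel)"
    using chisq_density_nonneg by (subst integral_eq_nn_integral) (auto simp: measure_def)
  then show ?thesis
    using True nu by (simp add: F_chi_def set_lebesgue_integral_def mult_le_0_iff not_le)
next
  case False
  then have "{\<omega> \<in> space M. S \<omega> \<le> s} = {}" using S_pos by force
  moreover have "sqrt \<nu> * s \<le> 0" using False nu by (simp add: mult_nonneg_nonpos)
  ultimately show ?thesis by (simp only: measure_empty F_chi_def if_True)
qed

text \<open>The variable \<nu> S^2 has a density, so S has no atoms. Continuity lets thresholds be
  approached from either side.\<close>

lemma isCont_F_chi: "isCont (\<lambda>s. F_chi \<nu> (sqrt \<nu> * s)) s"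
proof -
  interpret S: real_distribution "distr M borel S" by simp
  have "cdf (distr M borel S) = (\<lambda>s. F_chi \<nu> (sqrt \<nu> * s))"
    by (rule ext) (simp add: cdf_def measure_distr prob_S_le[symmetric] vimage_def Int_def conj_commute)
  moreover have "measure (distr M borel S) {s} = 0"
  proof -
    have "AE x in lborel. x \<noteq> \<nu> * s\<^sup>2" by (rule AE_lborel_singleton)
    then have "AE x in lborel. ennreal (chisq_density \<nu> x) * indicator {\<nu> * s\<^sup>2} x = 0"
      by eventually_elim simp
    then have "(\<integral>\<^sup>+x. ennreal (chisq_density \<nu> x) * indicator {\<nu> * s\<^sup>2} x \<partial>lborel) = (\<integral>\<^sup>+x. 0 \<partial>(lborel :: real measure))"
      by (rule nn_integral_cong_AE)
    then have "emeasure M ((\<lambda>\<omega>. \<nu> * (S \<omega>)\<^sup>2) -` {\<nu> * s\<^sup>2} \<inter> space M) = 0"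
      by (subst distributed_emeasure[OF S_distr]) simp_all
    moreover have "emeasure M (S -` {s} \<inter> space M) \<le> emeasure M ((\<lambda>\<omega>. \<nu> * (S \<omega>)\<^sup>2) -` {\<nu> * s\<^sup>2} \<inter> space M)"
      by (rule emeasure_mono) auto
    ultimately show ?thesis by (simp add: measure_def emeasure_distr)
  qed
  ultimately show ?thesis using S.isCont_cdf[of s] by simp
qed

lemma prob_X_ge: "i \<in> T \<Longrightarrow> prob {\<omega> \<in> space M. z \<le> X i \<omega>} = Phi (- z)"
proof -
  assume i: "i \<in> T"
  have "{\<omega> \<in> space M. z \<le> X i \<omega>} = X i -` {z..} \<inter> space M" by auto
  then have "emeasure M {\<omega> \<in> space M. z \<le> X i \<omega>}
      = (\<integral>\<^sup>+x. ennreal (std_normal_density x) * indicator {z..} x \<partial>lborel)"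
    using distributed_emeasure[OF X_distr[OF i], of "{z..}"] by simp
  also have "\<dots> = (\<integral>\<^sup>+x. ennreal (indicator {z..} x * std_normal_density x) \<partial>lborel)"
    by (intro nn_integral_cong) (auto split: split_indicator)
  finally have "prob {\<omega> \<in> space M. z \<le> X i \<omega>} = (\<integral>x. indicator {z..} x * std_normal_density x \<partial>lborel)"
    by (subst integral_eq_nn_integral) (auto simp: measure_def)
  then show ?thesis by (simp add: normal.F_minus_eq set_lebesgue_integral_def)
qed

section \<open>Empirical distribution of the normal variables\<close>

definition N :: "real \<Rightarrow> 'a \<Rightarrow> real" where "N z \<omega> = real (card {i \<in> T. z \<le> X i \<omega>})"

lemma N_eq: "N z \<omega> = (\<Sum>i\<in>T. indicator {z..} (X i \<omega>))"
  by (simp add: N_def indicator_def sum.If_cases Int_def)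

lemma measurable_N [measurable]: "N z \<in> borel_measurable M"
  unfolding N_eq[abs_def] by measurable

text \<open>Hoeffding's inequality for independent indicators. The bound depends only on \<eta> and
  \<open>card T\<close>, so it can be used across different probability spaces.\<close>

lemma prob_N_deviation:
  fixes \<eta> :: real
  assumes "T \<noteq> {}" "0 \<le> \<eta>"
  shows "prob {\<omega> \<in> space M. \<eta> * real (card T) \<le> \<bar>N z \<omega> - real (card T) * Phi (- z)\<bar>} \<le> 2 * exp (- 2 * \<eta>\<^sup>2 * real (card T))"
proof -
  let ?X = "\<lambda>j. case j of None \<Rightarrow> S | Some i \<Rightarrow> X i"
  let ?Y = "\<lambda>j \<omega>. indicator {z..} (?X j \<omega>) :: real"
  have c: "0 < card T" using assms by (simp add: card_gt_0_iff)
  have iv: "indep_vars (\<lambda>_. borel) ?Y (Some ` T)"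
    by (rule indep_vars_compose2[OF indep_vars_subset[OF indep]]) auto
  have E: "expectation (?Y (Some i)) = Phi (- z)" if "i \<in> T" for i
  proof -
    have "expectation (?Y (Some i)) = expectation (indicator {\<omega> \<in> space M. z \<le> X i \<omega>})"
      by (intro Bochner_Integration.integral_cong) (auto simp: indicator_def)
    then show ?thesis using that by (simp add: prob_X_ge)
  qed
  interpret H: Hoeffding_ineq M "Some ` T" ?Y "\<lambda>_. 0" "\<lambda>_. 1" "real (card T) * Phi (- z)"
  proof unfold_locales
    show "real (card T) * Phi (- z) \<equiv> \<Sum>j\<in>Some ` T. expectation (?Y j)"
      by (rule eq_reflection) (simp add: sum.reindex E del: option.case)
  qed (use iv in \<open>auto simp: indicator_def\<close>)
  have sum: "(\<Sum>j\<in>Some ` T. ?Y j \<omega>) = N z \<omega>" for \<omega> by (simp add: sum.reindex N_eq)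
  have one: "(\<Sum>j\<in>Some ` T. (1 - 0)\<^sup>2) = real (card T)" by (simp add: card_image)
  have "prob {\<omega> \<in> space M. \<eta> * real (card T) \<le> \<bar>N z \<omega> - real (card T) * Phi (- z)\<bar>}
      \<le> 2 * exp (- 2 * (\<eta> * real (card T))\<^sup>2 / real (card T))"
    using H.Hoeffding_ineq_abs_ge[of "\<eta> * real (card T)"] assms c unfolding sum one by simp
  also have "- 2 * (\<eta> * real (card T))\<^sup>2 / real (card T) = - 2 * \<eta>\<^sup>2 * real (card T)"
    using c by (simp add: power2_eq_square)
  finally show ?thesis .
qed

definition good :: "real set \<Rightarrow> real \<Rightarrow> 'a set" where
  "good Z \<eta> = {\<omega> \<in> space M. \<forall>z\<in>Z. \<bar>N z \<omega> - real (card T) * Phi (- z)\<bar> \<le> \<eta> * real (card T)}"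

lemma sets_good [measurable]: "finite Z \<Longrightarrow> good Z \<eta> \<in> sets M"
  unfolding good_def by measurable

lemma prob_not_good:
  fixes \<eta> :: real
  assumes "finite Z" "T \<noteq> {}" "0 \<le> \<eta>"
  shows "prob (space M - good Z \<eta>) \<le> real (card Z) * (2 * exp (- 2 * \<eta>\<^sup>2 * real (card T)))"
proof -
  let ?B = "\<lambda>z. {\<omega> \<in> space M. \<eta> * real (card T) \<le> \<bar>N z \<omega> - real (card T) * Phi (- z)\<bar>}"
  have "prob (space M - good Z \<eta>) \<le> prob (\<Union>z\<in>Z. ?B z)"
    using assms(1) by (intro finite_measure_mono) (auto simp: good_def)
  also have "\<dots> \<le> (\<Sum>z\<in>Z. prob (?B z))"
    using assms(1) by (intro finite_measure_subadditive_finite) auto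
  also have "\<dots> \<le> real (card Z) * (2 * exp (- 2 * \<eta>\<^sup>2 * real (card T)))"
    by (rule sum_bounded_above) (rule prob_N_deviation[OF assms(2,3)])
  finally show ?thesis .
qed

lemma p_le_iff:
  assumes "\<omega> \<in> space M" "i \<in> T"
  shows "p \<omega> i \<le> F_t \<nu> (- u) \<longleftrightarrow> S \<omega> * u \<le> X i \<omega>"
  using S_pos[OF assms(1)] assms(2)
  by (simp add: pval_def t.F_minus[symmetric] pos_le_divide_eq mult.commute)

text \<open>The bound on the grid extends to all z at once, so the random point z = S u may be
  inserted. The total 3 \<eta> consists of 2 \<eta> from the grid and \<eta> from the false
  hypotheses.\<close>

lemma ecdf_close_good:
  assumes grid: "\<And>g z. antimono g \<Longrightarrow> (\<And>z. 0 \<le> g z \<and> g z \<le> 1) \<Longrightarrow>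
      (\<And>z. z \<in> Z \<Longrightarrow> \<bar>g z - Phi (- z)\<bar> \<le> \<eta>) \<Longrightarrow> \<bar>g z - Phi (- z)\<bar> \<le> 2 * \<eta>"
    and T: "T \<noteq> {}" and few: "real (n - card T) \<le> \<eta> * real n" and \<omega>: "\<omega> \<in> good Z \<eta>"
  shows "ecdf_close n (p \<omega>) (S \<omega>) (3 * \<eta>)"
  unfolding ecdf_close_def
proof
  fix u
  let ?c = "real (card T)"
  define m where "m = real (n - card T)"
  have c: "0 < ?c" using T by (simp add: card_gt_0_iff)
  have \<omega>': "\<omega> \<in> space M" using \<omega> by (simp add: good_def)
  have dev: "\<bar>N z \<omega> - ?c * Phi (- z)\<bar> \<le> 2 * \<eta> * ?c" for z
  proof -
    have eq: "N z \<omega> / ?c - Phi (- z) = (N z \<omega> - ?c * Phi (- z)) / ?c" for z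
      using c T by (simp add: diff_divide_distrib)
    have "\<bar>N z \<omega> / ?c - Phi (- z)\<bar> \<le> 2 * \<eta>"
    proof (rule grid)
      show "antimono (\<lambda>z. N z \<omega> / ?c)"
        unfolding N_def by (intro antimonoI divide_right_mono of_nat_mono card_mono) auto
      have "N z \<omega> \<le> ?c" for z unfolding N_def by (intro of_nat_mono card_mono) auto
      then show "0 \<le> N z \<omega> / ?c \<and> N z \<omega> / ?c \<le> 1" for z
        using c by (simp add: N_def)
      show "\<bar>N z \<omega> / ?c - Phi (- z)\<bar> \<le> \<eta>" if "z \<in> Z" for z
        using \<omega> that c unfolding eq good_def by (simp add: abs_divide pos_divide_le_eq)
    qed
    then show ?thesis using c unfolding eq by (simp add: abs_divide pos_divide_le_eq)
  qed
  have "{j \<in> {..<n}. p \<omega> j \<le> F_t \<nu> (- u)} = ({..<n} - T) \<union> {i \<in> T. S \<omega> * u \<le> X i \<omega>}"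
  proof (rule set_eqI)
    fix j
    show "j \<in> {j \<in> {..<n}. p \<omega> j \<le> F_t \<nu> (- u)} \<longleftrightarrow> j \<in> ({..<n} - T) \<union> {i \<in> T. S \<omega> * u \<le> X i \<omega>}"
    proof (cases "j \<in> T")
      case True
      then show ?thesis using T_sub p_le_iff[OF \<omega>' True, of u] by auto
    next
      case False
      then show ?thesis using less_imp_le[OF t.F_pos[of "- u"]] by (simp add: pval_def)
    qed
  qed
  also have "card \<dots> = (n - card T) + card {i \<in> T. S \<omega> * u \<le> X i \<omega>}"
    using T_sub by (subst card_Un_disjoint) (auto simp: card_Diff_subset)
  finally have card: "real (card {j \<in> {..<n}. p \<omega> j \<le> F_t \<nu> (- u)}) = m + N (S \<omega> * u) \<omega>"
    by (simp add: N_def m_def)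
  have "real n = ?c + m" using card_T_le by (simp add: m_def)
  then have "real (card {j \<in> {..<n}. p \<omega> j \<le> F_t \<nu> (- u)}) - real n * Phi (- (S \<omega> * u))
      = (N (S \<omega> * u) \<omega> - ?c * Phi (- (S \<omega> * u))) + m * (1 - Phi (- (S \<omega> * u)))"
    unfolding card by (simp add: algebra_simps)
  moreover have "\<bar>m * (1 - Phi (- (S \<omega> * u)))\<bar> \<le> m * 1"
    unfolding abs_mult using normal.F_pos[of "- (S \<omega> * u)"] normal.F_less_1[of "- (S \<omega> * u)"]
    by (intro mult_mono) (auto simp: m_def)
  moreover have "0 \<le> \<eta>"
  proof (rule ccontr)
    assume "\<not> 0 \<le> \<eta>"
    then have "2 * \<eta> * ?c < 0" using c by (simp add: mult_neg_pos)
    then show False using dev[of 0] by linarith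
  qed
  then have "2 * \<eta> * ?c \<le> 2 * \<eta> * real n" using card_T_le by (intro mult_left_mono) auto
  ultimately show "\<bar>real (card {j \<in> {..<n}. p \<omega> j \<le> F_t \<nu> (- u)}) - real n * Phi (- (S \<omega> * u))\<bar> \<le> 3 * \<eta> * real n"
    using dev[of "S \<omega> * u"] few unfolding m_def[symmetric] by linarith
qed

text \<open>Since \<open>p i \<le> R * \<alpha> / n\<close> for every rejected hypothesis, \<open>1 / R \<le> \<alpha> / (n * p i)\<close>.\<close>

lemma fdp_le:
  assumes \<omega>: "\<omega> \<in> space M" and s: "0 < s" "s \<le> S \<omega>" and u: "0 < u" "s * u = A"
    and R: "real (R \<omega>) * \<alpha> / real n \<le> F_t \<nu> (- u)" and n: "0 < n"
  shows "real (V \<omega>) / real (max (R \<omega>) 1)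
    \<le> (\<Sum>i\<in>T. \<alpha> / real n * (indicator {A..} (X i \<omega>) / F_t \<nu> (- (X i \<omega> / s))))"
proof (cases "R \<omega> = 0")
  case True
  then have "V \<omega> = 0" using R_eq_V[of \<omega>] by simp
  then show ?thesis
    using alpha less_imp_le[OF t.F_pos] by (simp add: sum_nonneg indicator_def)
next
  case False
  let ?J = "lsu_rej \<alpha> n (p \<omega>) \<inter> T"
  have le: "1 / real (R \<omega>) \<le> \<alpha> / real n * (indicator {A..} (X i \<omega>) / F_t \<nu> (- (X i \<omega> / s)))"
    if "i \<in> ?J" for i
  proof -
    have i: "i \<in> T" "p \<omega> i \<le> real (R \<omega>) * \<alpha> / real n"
      using that unfolding R_eq lsu_rej_def by (auto split: if_splits)
    then have "p \<omega> i \<le> F_t \<nu> (- u)" using R by simp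
    then have X: "S \<omega> * u \<le> X i \<omega>" using p_le_iff[OF \<omega> i(1)] by simp
    have "A \<le> S \<omega> * u" unfolding u(2)[symmetric] using s u by (intro mult_right_mono) auto
    then have A: "A \<le> X i \<omega>" using X by simp
    have "0 < A" using s u by (metis mult_pos_pos)
    \<comment> \<open>Replacing S by the smaller constant s lowers the p-value and yields a bound
      that depends on X i alone.\<close>
    then have "X i \<omega> / S \<omega> \<le> X i \<omega> / s" using s A by (intro divide_left_mono) auto
    then have "F_t \<nu> (- (X i \<omega> / s)) \<le> F_t \<nu> (- (X i \<omega> / S \<omega>))" by simp
    also have "\<dots> = p \<omega> i" using i(1) by (simp add: pval_def t.F_minus)
    finally have "F_t \<nu> (- (X i \<omega> / s)) \<le> real (R \<omega>) * \<alpha> / real n" using i(2) by simp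
    then have "1 / real (R \<omega>) \<le> \<alpha> / real n / F_t \<nu> (- (X i \<omega> / s))"
      using t.F_pos[of "- (X i \<omega> / s)"] False n by (simp add: field_simps)
    then show ?thesis using A by simp
  qed
  have "real (V \<omega>) / real (max (R \<omega>) 1) = (\<Sum>i\<in>?J. 1 / real (R \<omega>))"
    using False by (simp add: V_count_def max_def)
  also have "\<dots> \<le> (\<Sum>i\<in>?J. \<alpha> / real n * (indicator {A..} (X i \<omega>) / F_t \<nu> (- (X i \<omega> / s))))"
    by (rule sum_mono) (rule le)
  also have "\<dots> \<le> (\<Sum>i\<in>T. \<alpha> / real n * (indicator {A..} (X i \<omega>) / F_t \<nu> (- (X i \<omega> / s))))"
    using alpha less_imp_le[OF t.F_pos] by (intro sum_mono2) (auto simp: indicator_def)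
  finally show ?thesis .
qed

lemma expectation_X_le:
  assumes "i \<in> T" and [measurable]: "h \<in> borel_measurable borel" and nonneg: "\<And>x. 0 \<le> h x"
    and le: "(\<integral>\<^sup>+x. ennreal (std_normal_density x) * ennreal (h x) \<partial>lborel) \<le> ennreal e" and e: "0 \<le> e"
  shows "integrable M (\<lambda>\<omega>. h (X i \<omega>))" "expectation (\<lambda>\<omega>. h (X i \<omega>)) \<le> e"
proof -
  have [measurable]: "X i \<in> borel_measurable M" using assms(1) by (rule measurable_X)
  have nn: "(\<integral>\<^sup>+\<omega>. ennreal (h (X i \<omega>)) \<partial>M) \<le> ennreal e"
    using le distributed_nn_integral[OF X_distr[OF assms(1)], of "\<lambda>x. ennreal (h x)"] by simp
  also have "\<dots> < \<infinity>" by simp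
  finally show int: "integrable M (\<lambda>\<omega>. h (X i \<omega>))"
    using nonneg by (intro integrableI_nonneg) auto
  have "ennreal (expectation (\<lambda>\<omega>. h (X i \<omega>))) \<le> ennreal e"
    using nn nn_integral_eq_integral[OF int] nonneg by simp
  then show "expectation (\<lambda>\<omega>. h (X i \<omega>)) \<le> e" using e by simp
qed

lemma fdp_le_1: "real (V \<omega>) / real (max (R \<omega>) 1) \<le> 1"
  by (auto simp: R_eq_V max_def divide_le_eq_1)

lemma integrable_fdp: "integrable M (\<lambda>\<omega>. real (V \<omega>) / real (max (R \<omega>) 1))"
proof (rule integrable_const_bound[of _ 1])
  have "(\<lambda>\<omega>. real (V \<omega>) / max (real (R \<omega>)) 1) \<in> borel_measurable M" by measurable
  then show "(\<lambda>\<omega>. real (V \<omega>) / real (max (R \<omega>) 1)) \<in> borel_measurable M"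
    by (simp only: of_nat_max of_nat_1)
  show "AE \<omega> in M. norm (real (V \<omega>) / real (max (R \<omega>) 1)) \<le> 1"
    using fdp_le_1 by (intro AE_I2) (simp only: real_norm_def abs_divide abs_of_nat)
qed

lemma expectation_fdp_ge:
  assumes [measurable]: "B \<in> sets M" and "0 \<le> d"
    and ge: "\<And>\<omega>. \<omega> \<in> B \<Longrightarrow> 1 - d \<le> real (V \<omega>) / real (max (R \<omega>) 1)"
  shows "prob B - d \<le> expectation (\<lambda>\<omega>. real (V \<omega>) / real (max (R \<omega>) 1))"
proof -
  have int: "integrable M (indicator B :: 'a \<Rightarrow> real)"
    by (rule integrable_const_bound[of _ 1]) (auto simp: indicator_def)
  have "prob B - d = expectation (\<lambda>\<omega>. indicator B \<omega> - d)"
    using int sets.sets_into_space[OF assms(1)] by (simp add: prob_space Int_absorb2)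
  also have "\<dots> \<le> expectation (\<lambda>\<omega>. real (V \<omega>) / real (max (R \<omega>) 1))"
  proof (intro integral_mono integrable_fdp Bochner_Integration.integrable_diff int integrable_const)
    show "indicator B \<omega> - d \<le> real (V \<omega>) / real (max (R \<omega>) 1)" for \<omega>
    proof (cases "\<omega> \<in> B")
      case True
      then show ?thesis using ge[OF True] by (simp only: indicator_simps)
    next
      case False
      have "- d \<le> 0" using assms(2) by simp
      also have "0 \<le> real (V \<omega>) / real (max (R \<omega>) 1)" by (intro divide_nonneg_nonneg) auto
      finally show ?thesis using False by simp
    qed
  qed
  finally show ?thesis .
qed

text \<open>On B the proportion is bounded by 1, off B by Y.\<close>

lemma expectation_fdp_le:
  assumes [measurable]: "B \<in> sets M" and Y: "integrable M Y" "\<And>\<omega>. 0 \<le> Y \<omega>"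
    and le: "\<And>\<omega>. \<omega> \<in> space M - B \<Longrightarrow> real (V \<omega>) / real (max (R \<omega>) 1) \<le> Y \<omega>"
  shows "expectation (\<lambda>\<omega>. real (V \<omega>) / real (max (R \<omega>) 1)) \<le> prob B + expectation Y"
proof -
  have int: "integrable M (indicator B :: 'a \<Rightarrow> real)"
    by (rule integrable_const_bound[of _ 1]) (auto simp: indicator_def)
  have "expectation (\<lambda>\<omega>. real (V \<omega>) / real (max (R \<omega>) 1)) \<le> expectation (\<lambda>\<omega>. indicator B \<omega> + Y \<omega>)"
  proof (intro integral_mono integrable_fdp Bochner_Integration.integrable_add int Y(1))
    show "real (V \<omega>) / real (max (R \<omega>) 1) \<le> indicator B \<omega> + Y \<omega>" if "\<omega> \<in> space M" for \<omega>
    proof (cases "\<omega> \<in> B")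
      case True
      then show ?thesis
        using add_mono[OF fdp_le_1[of \<omega>] Y(2)[of \<omega>]] by (simp only: indicator_simps add_0_right)
    next
      case False
      then have "indicator B \<omega> = (0 :: real)" by simp
      moreover have "real (V \<omega>) / real (max (R \<omega>) 1) \<le> Y \<omega>"
        using that False by (intro le) simp
      ultimately show ?thesis by linarith
    qed
  qed
  also have "\<dots> = prob B + expectation Y"
    using int Y(1) sets.sets_into_space[OF assms(1)] by (simp add: Int_absorb2)
  finally show ?thesis .
qed

end

section \<open>Limits\<close>

locale t_model_seq = tangent_point \<alpha> \<nu> t2 for \<alpha> \<nu> t2 :: real +
  fixes M :: "nat \<Rightarrow> 'a measure" and T :: "nat \<Rightarrow> nat set"
    and X :: "nat \<Rightarrow> nat \<Rightarrow> 'a \<Rightarrow> real" and S :: "nat \<Rightarrow> 'a \<Rightarrow> real"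
  assumes model: "\<And>n. t_model \<alpha> \<nu> t2 (M n) n (T n) (X n) (S n)"
    and zeta: "(\<lambda>n. real (card (T n)) / real n) \<longlonglongrightarrow> 1"
begin

abbreviation H :: "real \<Rightarrow> real" where "H s \<equiv> F_chi \<nu> (sqrt \<nu> * s)"
abbreviation R :: "nat \<Rightarrow> 'a \<Rightarrow> nat" where "R n \<equiv> R_count \<nu> \<alpha> n (T n) (X n) (S n)"
abbreviation V :: "nat \<Rightarrow> 'a \<Rightarrow> nat" where "V n \<equiv> V_count \<nu> \<alpha> n (T n) (X n) (S n)"
abbreviation false_frac :: "nat \<Rightarrow> real" where "false_frac n \<equiv> real (n - card (T n)) / real n"

lemma card_T_le: "card (T n) \<le> n"
  using t_model.card_T_le[OF model] .

lemma false_frac_tendsto: "false_frac \<longlonglongrightarrow> 0"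
proof -
  have "(\<lambda>n. 1 - real (card (T n)) / real n) \<longlonglongrightarrow> 0"
    using tendsto_diff[OF tendsto_const[of 1] zeta] by simp
  moreover have "eventually (\<lambda>n. 1 - real (card (T n)) / real n = false_frac n) sequentially"
    using eventually_gt_at_top[of 0]
  proof eventually_elim
    case (elim n)
    then show ?case using card_T_le[of n] by (simp add: of_nat_diff diff_divide_distrib)
  qed
  ultimately show ?thesis by (rule Lim_transform_eventually)
qed

lemma card_T_at_top: "filterlim (\<lambda>n. real (card (T n))) at_top sequentially"
proof (rule filterlim_at_top_mono)
  show "filterlim (\<lambda>n. 1 / 2 * real n) at_top sequentially" by real_asymp
  have "eventually (\<lambda>n. 1 / 2 < real (card (T n)) / real n) sequentially"
    using order_tendstoD(1)[OF zeta, of "1 / 2"] by simp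
  then show "eventually (\<lambda>n. 1 / 2 * real n \<le> real (card (T n))) sequentially"
    using eventually_gt_at_top[of 0] by eventually_elim (simp add: field_simps)
qed

text \<open>Packs the deviation estimates into events of probability tending to 1, on which the
  deterministic step-up bounds apply whatever the value of S.\<close>

lemma good_events:
  assumes "0 < \<delta>"
  obtains G where "\<And>n. G n \<in> sets (M n)" "(\<lambda>n. measure (M n) (space (M n) - G n)) \<longlonglongrightarrow> 0"
    "eventually (\<lambda>n. \<forall>\<omega>\<in>G n. ecdf_close n (pval \<nu> (T n) (X n) (S n) \<omega>) (S n \<omega>) \<delta>) sequentially"
proof -
  define \<eta> where "\<eta> = \<delta> / 3"
  have \<eta>: "0 < \<eta>" "\<delta> = 3 * \<eta>" using assms by (simp_all add: \<eta>_def)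
  obtain Z where Z: "finite Z"
    "\<And>g z. antimono g \<Longrightarrow> (\<And>z. 0 \<le> g z \<and> g z \<le> 1) \<Longrightarrow> (\<And>z. z \<in> Z \<Longrightarrow> \<bar>g z - Phi (- z)\<bar> \<le> \<eta>) \<Longrightarrow>
       \<bar>g z - Phi (- z)\<bar> \<le> 2 * \<eta>"
    using normal_grid[OF \<eta>(1)] by blast
  \<comment> \<open>Written out because \<open>good\<close> belongs to the model for a single n; it
    coincides with \<open>m.good Z \<eta>\<close> in each of them.\<close>
  define G where "G n = {\<omega> \<in> space (M n). \<forall>z\<in>Z.
      \<bar>real (card {i \<in> T n. z \<le> X n i \<omega>}) - real (card (T n)) * Phi (- z)\<bar> \<le> \<eta> * real (card (T n))}" for n
  define b where "b n = card Z * (2 * exp (- 2 * \<eta>\<^sup>2 * real (card (T n))))" for n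
  have G_sets: "G n \<in> sets (M n)" for n
  proof -
    interpret m: t_model \<alpha> \<nu> t2 "M n" n "T n" "X n" "S n" by (rule model)
    have "G n = m.good Z \<eta>" unfolding G_def m.good_def m.N_def ..
    then show ?thesis using Z(1) by simp
  qed
  have G_prob: "measure (M n) (space (M n) - G n) \<le> b n" if "T n \<noteq> {}" for n
  proof -
    interpret m: t_model \<alpha> \<nu> t2 "M n" n "T n" "X n" "S n" by (rule model)
    have "G n = m.good Z \<eta>" unfolding G_def m.good_def m.N_def ..
    then show ?thesis
      using m.prob_not_good[OF Z(1) that, of \<eta>] \<eta> by (simp add: b_def)
  qed
  have G_close: "ecdf_close n (pval \<nu> (T n) (X n) (S n) \<omega>) (S n \<omega>) \<delta>"
    if "T n \<noteq> {}" "real (n - card (T n)) \<le> \<eta> * real n" "\<omega> \<in> G n" for n \<omega>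
  proof -
    interpret m: t_model \<alpha> \<nu> t2 "M n" n "T n" "X n" "S n" by (rule model)
    have "G n = m.good Z \<eta>" unfolding G_def m.good_def m.N_def ..
    then have "\<omega> \<in> m.good Z \<eta>" using that by simp
    with that(1,2) show ?thesis
      unfolding \<eta>(2) by (rule m.ecdf_close_good[where Z = Z and \<eta> = \<eta>, rotated]) (rule Z(2))
  qed
  have T: "eventually (\<lambda>n. T n \<noteq> {}) sequentially"
    using filterlim_at_top_dense[THEN iffD1, OF card_T_at_top, rule_format, of 0]
    by eventually_elim auto
  have "eventually (\<lambda>n. false_frac n < \<eta>) sequentially"
    by (rule order_tendstoD(2)[OF false_frac_tendsto \<eta>(1)])
  then have few: "eventually (\<lambda>n. real (n - card (T n)) \<le> \<eta> * real n) sequentially"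
    using eventually_gt_at_top[of 0] by eventually_elim (simp add: field_simps)
  have "((\<lambda>c. card Z * (2 * exp (- 2 * \<eta>\<^sup>2 * c))) \<longlongrightarrow> 0) at_top"
    using \<eta>(1) by real_asymp
  then have b: "b \<longlonglongrightarrow> 0"
    unfolding b_def[abs_def] by (rule filterlim_compose) (rule card_T_at_top)
  show thesis
  proof (rule that[of G])
    show "(\<lambda>n. measure (M n) (space (M n) - G n)) \<longlonglongrightarrow> 0"
      by (rule tendsto_sandwich[OF _ _ tendsto_const b])
        (auto intro!: always_eventually eventually_mono[OF T] G_prob)
    show "eventually (\<lambda>n. \<forall>\<omega>\<in>G n. ecdf_close n (pval \<nu> (T n) (X n) (S n) \<omega>) (S n \<omega>) \<delta>) sequentially"
      using T few by eventually_elim (use G_close in blast)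
  qed (rule G_sets)
qed

section \<open>Limit of the rejection rate\<close>

lemma H_nonpos: "s \<le> 0 \<Longrightarrow> H s = 0"
  using nu by (simp add: F_chi_def mult_nonneg_nonpos)

lemma isCont_H: "isCont H s"
  using t_model.isCont_F_chi[OF model] .

text \<open>The step-up bounds need a scale strictly beyond the threshold; continuity provides one
  at a small cost in probability.\<close>

lemma H_right:
  assumes "H c < y"
  obtains s where "c < s" "H s < y"
proof -
  have "(H \<longlongrightarrow> H c) (at_right c)"
    using isCont_H[of c] by (simp add: isCont_def filterlim_at_split)
  then have "eventually (\<lambda>s. H s < y \<and> c < s) (at_right c)"
    using assms by (intro eventually_conj order_tendstoD(2) eventually_at_right_less)
  then show thesis using that eventually_happens'[of "at_right c"] by (auto simp: trivial_limit_at_right_real)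
qed

lemma H_left:
  assumes "y < H c" "a < c"
  obtains s where "a < s" "s < c" "y < H s"
proof -
  have "(H \<longlongrightarrow> H c) (at_left c)"
    using isCont_H[of c] by (simp add: isCont_def filterlim_at_split)
  then have "eventually (\<lambda>s. y < H s \<and> a < s \<and> s < c) (at_left c)"
    using assms eventually_at_left_real[OF assms(2)]
    by (intro eventually_conj order_tendstoD(1)) (auto elim: eventually_mono)
  then show thesis using that eventually_happens'[of "at_left c"] by (auto simp: trivial_limit_at_left_real)
qed

lemma tail_limit:
  assumes "0 < x" "x < 1"
  shows "(\<lambda>n. measure (M n) {\<omega> \<in> space (M n). x \<le> real (R n \<omega>) / real n}) \<longlonglongrightarrow> H (threshold x)"
proof (rule order_tendstoI)
  fix y assume y: "H (threshold x) < y"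
  \<comment> \<open>The threshold may be negative, but the step-up bound needs a positive scale; H
    does not notice the change.\<close>
  let ?c = "max 0 (threshold x)"
  have "H ?c < y" using y H_nonpos[of 0] H_nonpos[of "threshold x"] by (auto simp: max_def)
  then obtain s where s: "?c < s" "H s < y" by (rule H_right)
  obtain \<delta> where \<delta>: "0 < \<delta>"
    "\<And>n p s'. 0 < n \<Longrightarrow> s \<le> s' \<Longrightarrow> ecdf_close n p s' \<delta> \<Longrightarrow> real (lsu_m \<alpha> n p) < real n * x"
    using lsu_m_less[OF assms, of s] s by auto
  obtain G where G: "\<And>n. G n \<in> sets (M n)" "(\<lambda>n. measure (M n) (space (M n) - G n)) \<longlonglongrightarrow> 0"
    "eventually (\<lambda>n. \<forall>\<omega>\<in>G n. ecdf_close n (pval \<nu> (T n) (X n) (S n) \<omega>) (S n \<omega>) \<delta>) sequentially"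
    using good_events[OF \<delta>(1)] by blast
  have "eventually (\<lambda>n. measure (M n) (space (M n) - G n) < y - H s) sequentially"
    using s by (intro order_tendstoD(2)[OF G(2)]) simp
  then show "eventually (\<lambda>n. measure (M n) {\<omega> \<in> space (M n). x \<le> real (R n \<omega>) / real n} < y) sequentially"
    using G(3) eventually_gt_at_top[of 0]
  proof eventually_elim
    case (elim n)
    interpret m: t_model \<alpha> \<nu> t2 "M n" n "T n" "X n" "S n" by (rule model)
    have "{\<omega> \<in> space (M n). x \<le> real (R n \<omega>) / real n}
        \<subseteq> {\<omega> \<in> space (M n). S n \<omega> \<le> s} \<union> (space (M n) - G n)"
    proof (intro subsetI, rule ccontr)
      fix \<omega> assume \<omega>: "\<omega> \<in> {\<omega> \<in> space (M n). x \<le> real (R n \<omega>) / real n}"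
        "\<omega> \<notin> {\<omega> \<in> space (M n). S n \<omega> \<le> s} \<union> (space (M n) - G n)"
      then have "real (R n \<omega>) < real n * x"
        unfolding m.R_eq using elim by (intro \<delta>(2)[where s' = "S n \<omega>"]) auto
      then show False using \<omega> elim by (simp add: field_simps)
    qed
    then have "measure (M n) {\<omega> \<in> space (M n). x \<le> real (R n \<omega>) / real n}
        \<le> measure (M n) ({\<omega> \<in> space (M n). S n \<omega> \<le> s} \<union> (space (M n) - G n))"
      using G(1)[of n] by (intro m.finite_measure_mono) auto
    also have "\<dots> \<le> H s + measure (M n) (space (M n) - G n)"
      unfolding m.prob_S_le[symmetric] using G(1)[of n] by (intro measure_Un_le) auto
    finally show ?case using elim by linarith
  qed
next
  fix y assume y: "y < H (threshold x)"
  show "eventually (\<lambda>n. y < measure (M n) {\<omega> \<in> space (M n). x \<le> real (R n \<omega>) / real n}) sequentially"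
  proof (cases "0 < threshold x")
    case False
    then have "y < 0" using y H_nonpos by simp
    then show ?thesis by (intro always_eventually allI) (rule less_le_trans[OF _ measure_nonneg])
  next
    case True
    obtain s where s: "0 < s" "s < threshold x" "y < H s"
      using H_left[OF y True] by blast
    obtain \<delta> N where \<delta>: "0 < \<delta>"
      "\<And>n p s'. N \<le> n \<Longrightarrow> s' \<le> s \<Longrightarrow> ecdf_close n p s' \<delta> \<Longrightarrow> real n * x \<le> real (lsu_m \<alpha> n p)"
      using lsu_m_ge[OF assms s(1,2)] by blast
    obtain G where G: "\<And>n. G n \<in> sets (M n)" "(\<lambda>n. measure (M n) (space (M n) - G n)) \<longlonglongrightarrow> 0"
      "eventually (\<lambda>n. \<forall>\<omega>\<in>G n. ecdf_close n (pval \<nu> (T n) (X n) (S n) \<omega>) (S n \<omega>) \<delta>) sequentially"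
      using good_events[OF \<delta>(1)] by blast
    have "eventually (\<lambda>n. measure (M n) (space (M n) - G n) < H s - y) sequentially"
      using s by (intro order_tendstoD(2)[OF G(2)]) simp
    then show ?thesis
      using G(3) eventually_ge_at_top[of N] eventually_gt_at_top[of 0]
    proof eventually_elim
      case (elim n)
      interpret m: t_model \<alpha> \<nu> t2 "M n" n "T n" "X n" "S n" by (rule model)
      let ?E = "{\<omega> \<in> space (M n). x \<le> real (R n \<omega>) / real n}"
      have "{\<omega> \<in> space (M n). S n \<omega> \<le> s} \<subseteq> ?E \<union> (space (M n) - G n)"
      proof (intro subsetI)
        fix \<omega> assume \<omega>: "\<omega> \<in> {\<omega> \<in> space (M n). S n \<omega> \<le> s}"
        show "\<omega> \<in> ?E \<union> (space (M n) - G n)"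
        proof (cases "\<omega> \<in> G n")
          case True
          then have "real n * x \<le> real (R n \<omega>)"
            unfolding m.R_eq using elim \<omega> by (intro \<delta>(2)[where s' = "S n \<omega>"]) auto
          then show ?thesis using \<omega> elim by (simp add: field_simps)
        qed (use \<omega> in simp)
      qed
      then have "H s \<le> measure (M n) (?E \<union> (space (M n) - G n))"
        unfolding m.prob_S_le[symmetric] using G(1)[of n] by (intro m.finite_measure_mono) auto
      also have "\<dots> \<le> measure (M n) ?E + measure (M n) (space (M n) - G n)"
        using G(1)[of n] by (intro measure_Un_le) auto
      finally show ?case using elim by linarith
    qed
  qed
qed

lemma t2_less: "t2 < \<alpha> / 2"
proof -
  have "F_t \<nu> (- u2) < \<alpha> / 2" using gap_zero_less[OF gap_s2 u2] s2 by simp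
  then show ?thesis by (simp only: t2[symmetric])
qed

lemma plateau_bounds: "0 < t2 / \<alpha>" "t2 / \<alpha> < 1"
  using t2_less t2_pos alpha by (simp_all add: field_simps)

text \<open>The plateau has length t2 / \<alpha> and constant height \<open>H s2\<close>, whence the
  first term of the EER limit.\<close>

lemma integral_threshold:
  assumes "(\<lambda>x. H (threshold x)) integrable_on {0..1}"
  shows "integral {0..1} (\<lambda>x. H (threshold x))
    = t2 * H s2 / \<alpha> + integral {t2 / \<alpha>..1} (\<lambda>x. H (s_cross \<nu> \<alpha> (\<alpha> * x)))"
proof -
  let ?c = "t2 / \<alpha>"
  have "integral {0..1} (\<lambda>x. H (threshold x))
      = integral {0..?c} (\<lambda>x. H (threshold x)) + integral {?c..1} (\<lambda>x. H (threshold x))"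
    using plateau_bounds assms by (intro Henstock_Kurzweil_Integration.integral_combine[symmetric]) auto
  also have "integral {0..?c} (\<lambda>x. H (threshold x)) = integral {0..?c} (\<lambda>x. H s2)"
    by (intro Henstock_Kurzweil_Integration.integral_cong) (simp add: threshold_def)
  also have "\<dots> = t2 * H s2 / \<alpha>" using plateau_bounds(1) by simp
  also have "integral {?c..1} (\<lambda>x. H (threshold x)) = integral {?c..1} (\<lambda>x. H (s_cross \<nu> \<alpha> (\<alpha> * x)))"
  proof (rule Henstock_Kurzweil_Integration.integral_cong)
    fix x assume "x \<in> {?c..1}"
    then consider "x = ?c" | "?c < x" by fastforce
    then show "H (threshold x) = H (s_cross \<nu> \<alpha> (\<alpha> * x))"
    proof cases
      case 1
      then have "\<alpha> * x = t2" using alpha by simp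
      then show ?thesis using 1 by (simp add: threshold_def s2_def)
    qed (simp add: threshold_def)
  qed
  finally show ?thesis .
qed

text \<open>Dominated convergence for the tail probabilities, on the open interval because their
  limit is known only for 0 < x < 1.\<close>

lemma rejection_rate_tendsto:
  "(\<lambda>n. \<integral>\<omega>. real (R n \<omega>) / real n \<partial>M n) \<longlonglongrightarrow>
    t2 * H s2 / \<alpha> + integral {t2 / \<alpha>..1} (\<lambda>x. H (s_cross \<nu> \<alpha> (\<alpha> * x)))"
proof -
  define f where "f n x = measure (M n) {\<omega> \<in> space (M n). x \<le> real (R n \<omega>) / real n}" for n x
  have f: "(f n has_integral (\<integral>\<omega>. real (R n \<omega>) / real n \<partial>M n)) {0..1}" for n
  proof -
    interpret m: t_model \<alpha> \<nu> t2 "M n" n "T n" "X n" "S n" by (rule model)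
    have "real (R n \<omega>) / real n \<le> 1" for \<omega>
      using m.R_le[of \<omega>] by (auto simp: divide_le_eq_1)
    then show ?thesis
      unfolding f_def by (intro m.expectation_eq_integral_tail) auto
  qed
  have f_le: "norm (f n x) \<le> 1" for n x
  proof -
    interpret m: t_model \<alpha> \<nu> t2 "M n" n "T n" "X n" "S n" by (rule model)
    show ?thesis by (simp add: f_def)
  qed
  have f_open: "f n integrable_on {0<..<1}" for n
    using f[of n] by (simp add: has_integral_integrable integrable_on_open_interval_real)
  have one: "(\<lambda>_. 1 :: real) integrable_on {0<..<1::real}"
    using integrable_const_ivl[of 1 0 1] by (simp only: integrable_on_open_interval_real)
  have lim: "(\<lambda>n. f n x) \<longlonglongrightarrow> H (threshold x)" if "x \<in> {0<..<1}" for x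
    using tail_limit[of x] that by (simp add: f_def)
  note dom = dominated_convergence[of f "{0<..<1}" "\<lambda>_. 1" "\<lambda>x. H (threshold x)", OF f_open one f_le lim]
  have "(\<lambda>n. integral {0<..<1} (f n)) = (\<lambda>n. \<integral>\<omega>. real (R n \<omega>) / real n \<partial>M n)"
    by (simp only: integral_open_interval_real[symmetric] integral_unique[OF f])
  moreover have "integral {0<..<1} (\<lambda>x. H (threshold x))
      = t2 * H s2 / \<alpha> + integral {t2 / \<alpha>..1} (\<lambda>x. H (s_cross \<nu> \<alpha> (\<alpha> * x)))"
    using dom(1) integral_threshold
    by (simp only: integral_open_interval_real[symmetric] integrable_on_open_interval_real)
  ultimately show ?thesis using dom(2) by simp
qed

lemma EER_tendsto:
  "(\<lambda>n. \<integral>\<omega>. real (V n \<omega>) / real n \<partial>M n) \<longlonglongrightarrow>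
    t2 * H s2 / \<alpha> + integral {t2 / \<alpha>..1} (\<lambda>x. H (s_cross \<nu> \<alpha> (\<alpha> * x)))"
proof -
  have "(\<integral>\<omega>. real (V n \<omega>) / real n \<partial>M n) = (\<integral>\<omega>. real (R n \<omega>) / real n \<partial>M n) - false_frac n" for n
  proof -
    interpret m: t_model \<alpha> \<nu> t2 "M n" n "T n" "X n" "S n" by (rule model)
    have "integrable (M n) (\<lambda>\<omega>. real (R n \<omega>) / real n)"
      by (rule m.integrable_const_bound[of _ 1]) (use m.R_le in \<open>auto simp: divide_le_eq_1\<close>)
    then show ?thesis by (simp add: m.V_eq diff_divide_distrib m.prob_space)
  qed
  then show ?thesis
    using tendsto_diff[OF rejection_rate_tendsto false_frac_tendsto] by simp
qed

lemma FDR_tendsto: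
  "(\<lambda>n. \<integral>\<omega>. real (V n \<omega>) / real (max (R n \<omega>) 1) \<partial>M n) \<longlonglongrightarrow> H s2"
proof (rule order_tendstoI)
  fix y assume y: "y < H s2"
  \<comment> \<open>Below s2 at least about the plateau fraction c is rejected, so the false
    hypotheses make up at most \<open>false_frac n / c\<close> of the rejections.\<close>
  define c where "c = t2 / \<alpha>"
  have c: "0 < c" "c < 1" using plateau_bounds by (simp_all only: c_def)
  obtain s where s: "0 < s" "s < s2" "y < H s" using H_left[OF y s2] by blast
  have thr: "threshold c = s2" by (simp add: threshold_def c_def)
  obtain \<delta> N where \<delta>: "0 < \<delta>"
    "\<And>n p s'. N \<le> n \<Longrightarrow> s' \<le> s \<Longrightarrow> ecdf_close n p s' \<delta> \<Longrightarrow> real n * c \<le> real (lsu_m \<alpha> n p)"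
    using lsu_m_ge[OF c s(1) s(2)[folded thr]] by blast
  obtain G where G: "\<And>n. G n \<in> sets (M n)" "(\<lambda>n. measure (M n) (space (M n) - G n)) \<longlonglongrightarrow> 0"
    "eventually (\<lambda>n. \<forall>\<omega>\<in>G n. ecdf_close n (pval \<nu> (T n) (X n) (S n) \<omega>) (S n \<omega>) \<delta>) sequentially"
    using good_events[OF \<delta>(1)] by blast
  have "(\<lambda>n. measure (M n) (space (M n) - G n) + false_frac n / c) \<longlonglongrightarrow> 0 + 0 / c"
    using c by (intro tendsto_intros G(2) false_frac_tendsto) simp
  then have "(\<lambda>n. measure (M n) (space (M n) - G n) + false_frac n / c) \<longlonglongrightarrow> 0"
    by (simp only: div_0 add_0_right)
  moreover have "0 < H s - y" using s by simp
  ultimately have "eventually (\<lambda>n. measure (M n) (space (M n) - G n) + false_frac n / c < H s - y) sequentially"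
    by (rule order_tendstoD(2))
  then show "eventually (\<lambda>n. y < (\<integral>\<omega>. real (V n \<omega>) / real (max (R n \<omega>) 1) \<partial>M n)) sequentially"
    using G(3) eventually_ge_at_top[of N] eventually_gt_at_top[of 0]
  proof eventually_elim
    case (elim n)
    interpret m: t_model \<alpha> \<nu> t2 "M n" n "T n" "X n" "S n" by (rule model)
    let ?E = "{\<omega> \<in> space (M n). S n \<omega> \<le> s}"
    let ?B = "?E - (space (M n) - G n)"
    have [measurable]: "G n \<in> sets (M n)" by (rule G)
    have "m.prob ?B - false_frac n / c \<le> (\<integral>\<omega>. real (V n \<omega>) / real (max (R n \<omega>) 1) \<partial>M n)"
    proof (rule m.expectation_fdp_ge)
      show "0 \<le> false_frac n / c" using c by (intro divide_nonneg_nonneg) auto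
      fix \<omega> assume \<omega>: "\<omega> \<in> ?B"
      then have R: "real n * c \<le> real (R n \<omega>)"
        unfolding m.R_eq using elim by (intro \<delta>(2)[where s' = "S n \<omega>"]) auto
      have pos: "0 < real n * c" using elim c by (intro mult_pos_pos) auto
      have R_pos: "0 < real (R n \<omega>)" using R pos by linarith
      then have "real (max (R n \<omega>) 1) = real (R n \<omega>)" by simp
      then have "real (V n \<omega>) / real (max (R n \<omega>) 1) = 1 - real (n - card (T n)) / real (R n \<omega>)"
        unfolding m.V_eq using R_pos by (simp only: diff_divide_distrib) simp
      moreover have "real (n - card (T n)) / real (R n \<omega>) \<le> real (n - card (T n)) / (real n * c)"
        by (intro divide_left_mono mult_pos_pos R R_pos pos) auto
      ultimately show "1 - false_frac n / c \<le> real (V n \<omega>) / real (max (R n \<omega>) 1)"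
        by (simp only: divide_divide_eq_left)
    qed measurable
    moreover have "H s \<le> m.prob ?B + m.prob (space (M n) - G n)"
    proof -
      have "H s \<le> m.prob (?B \<union> (space (M n) - G n))"
        unfolding m.prob_S_le[symmetric] by (intro m.finite_measure_mono) auto
      also have "\<dots> \<le> m.prob ?B + m.prob (space (M n) - G n)"
        by (intro measure_Un_le) auto
      finally show ?thesis .
    qed
    ultimately show ?case using elim by linarith
  qed
next
  fix y assume y: "H s2 < y"
  obtain s where s: "s2 < s" "H s < y" using H_right[OF y] by blast
  have s_pos: "0 < s" using s s2 by simp
  \<comment> \<open>Half of the available room: one e for the failure of the good event, one for the
    reciprocal bound.\<close>
  define e where "e = (y - H s) / 2"
  have e: "0 < e" using s by (simp add: e_def)
  obtain A where A: "0 < A" "(\<integral>\<^sup>+x. ennreal (std_normal_density x) *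
      ennreal (indicator {A..} x / F_t \<nu> (- (x / s))) \<partial>lborel) \<le> ennreal e"
    using nn_integral_inverse_p_tail[OF nu s_pos e] by blast
  \<comment> \<open>The cutoff exceeds A, so the tail integral is at most e, and its coordinate u is
    at least u2, so the corresponding rejection level lies on the plateau.\<close>
  define h where "h x = indicator {s * max u2 (A / s)..} x / F_t \<nu> (- (x / s))" for x :: real
  define u where "u = max u2 (A / s)"
  have u: "0 < u" "u2 \<le> u" "A \<le> s * u"
  proof -
    show "0 < u" "u2 \<le> u" using u2 by (simp_all add: u_def)
    have "A = s * (A / s)" using s_pos by simp
    also have "\<dots> \<le> s * u" using s_pos by (intro mult_left_mono) (simp_all add: u_def)
    finally show "A \<le> s * u" .
  qed
  have h_nonneg: "0 \<le> h x" for x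
    using less_imp_le[OF t.F_pos] by (simp add: h_def)
  have [measurable]: "h \<in> borel_measurable borel"
    unfolding h_def by measurable
  have "h x \<le> indicator {A..} x / F_t \<nu> (- (x / s))" for x
    unfolding h_def u_def[symmetric] using u t.F_pos[of "- (x / s)"]
    by (intro divide_right_mono) (auto split: split_indicator)
  then have "(\<integral>\<^sup>+x. ennreal (std_normal_density x) * ennreal (h x) \<partial>lborel) \<le> (\<integral>\<^sup>+x. ennreal (std_normal_density x) *
      ennreal (indicator {A..} x / F_t \<nu> (- (x / s))) \<partial>lborel)"
    by (intro nn_integral_mono mult_left_mono ennreal_leI) auto
  then have h: "(\<integral>\<^sup>+x. ennreal (std_normal_density x) * ennreal (h x) \<partial>lborel) \<le> ennreal e"
    using A(2) by (rule order_trans)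
  \<comment> \<open>For S above s > s2 the fraction R / n drops below x on the good event, hence
    every rejected p-value is at most F_t (- u), as \<open>m.fdp_le\<close> requires.\<close>
  define x where "x = F_t \<nu> (- u) / \<alpha>"
  have "F_t \<nu> (- u) \<le> F_t \<nu> (- u2)" using u by simp
  then have "F_t \<nu> (- u) \<le> t2" by (simp only: t2[symmetric])
  then have "x \<le> t2 / \<alpha>" unfolding x_def using alpha by (intro divide_right_mono) auto
  then have x: "x < 1" "threshold x = s2" using plateau_bounds(2) by (simp_all add: threshold_def)
  have x_pos: "0 < x" and \<alpha>x: "\<alpha> * x = F_t \<nu> (- u)"
    using t.F_pos[of "- u"] alpha by (simp_all add: x_def)
  obtain \<delta> where \<delta>: "0 < \<delta>"
    "\<And>n p s'. 0 < n \<Longrightarrow> s \<le> s' \<Longrightarrow> ecdf_close n p s' \<delta> \<Longrightarrow> real (lsu_m \<alpha> n p) < real n * x"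
    using lsu_m_less[OF x_pos x(1) s_pos] s x(2) by auto
  obtain G where G: "\<And>n. G n \<in> sets (M n)" "(\<lambda>n. measure (M n) (space (M n) - G n)) \<longlonglongrightarrow> 0"
    "eventually (\<lambda>n. \<forall>\<omega>\<in>G n. ecdf_close n (pval \<nu> (T n) (X n) (S n) \<omega>) (S n \<omega>) \<delta>) sequentially"
    using good_events[OF \<delta>(1)] by blast
  have "eventually (\<lambda>n. measure (M n) (space (M n) - G n) < e) sequentially"
    by (rule order_tendstoD(2)[OF G(2) e])
  then show "eventually (\<lambda>n. (\<integral>\<omega>. real (V n \<omega>) / real (max (R n \<omega>) 1) \<partial>M n) < y) sequentially"
    using G(3) eventually_gt_at_top[of 0]
  proof eventually_elim
    case (elim n)
    interpret m: t_model \<alpha> \<nu> t2 "M n" n "T n" "X n" "S n" by (rule model)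
    let ?E = "{\<omega> \<in> space (M n). S n \<omega> \<le> s}"
    let ?B = "?E \<union> (space (M n) - G n)"
    let ?Y = "\<lambda>\<omega>. \<Sum>i\<in>T n. \<alpha> / real n * h (X n i \<omega>)"
    have [measurable]: "G n \<in> sets (M n)" by (rule G)
    have int_h: "integrable (M n) (\<lambda>\<omega>. h (X n i \<omega>))" "(\<integral>\<omega>. h (X n i \<omega>) \<partial>M n) \<le> e" if "i \<in> T n" for i
      using m.expectation_X_le[OF that _ h_nonneg h] e by auto
    have "(\<integral>\<omega>. real (V n \<omega>) / real (max (R n \<omega>) 1) \<partial>M n) \<le> m.prob ?B + (\<integral>\<omega>. ?Y \<omega> \<partial>M n)"
    proof (rule m.expectation_fdp_le)
      show "integrable (M n) ?Y"
        by (intro Bochner_Integration.integrable_sum integrable_mult_right int_h)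
      show "0 \<le> ?Y \<omega>" for \<omega>
        using h_nonneg alpha by (intro sum_nonneg mult_nonneg_nonneg) auto
      fix \<omega> assume "\<omega> \<in> space (M n) - ?B"
      then have \<omega>: "\<omega> \<in> space (M n)" "s \<le> S n \<omega>" "\<omega> \<in> G n" by auto
      have "real (R n \<omega>) < real n * x"
        unfolding m.R_eq using elim \<omega> by (intro \<delta>(2)[where s' = "S n \<omega>"]) auto
      then have "real (R n \<omega>) * \<alpha> / real n \<le> \<alpha> * x"
        using elim alpha by (simp add: field_simps)
      then show "real (V n \<omega>) / real (max (R n \<omega>) 1) \<le> ?Y \<omega>"
        unfolding h_def u_def[symmetric] \<alpha>x
        by (intro m.fdp_le[OF \<omega>(1) s_pos \<omega>(2) u(1) refl]) (use elim in auto)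
    qed measurable
    moreover have "(\<integral>\<omega>. ?Y \<omega> \<partial>M n) \<le> e"
    proof -
      have "(\<integral>\<omega>. ?Y \<omega> \<partial>M n) = (\<Sum>i\<in>T n. \<alpha> / real n * (\<integral>\<omega>. h (X n i \<omega>) \<partial>M n))"
        using int_h by (subst Bochner_Integration.integral_sum) auto
      \<comment> \<open>At most n summands, each of size \<alpha> e / n: the factor 1 / n from the
        reciprocal bound cancels the number of hypotheses.\<close>
      also have "\<dots> \<le> real (card (T n)) * (\<alpha> / real n * e)"
        using int_h alpha by (intro sum_bounded_above mult_left_mono) auto
      also have "\<dots> \<le> real n * (\<alpha> / real n * e)"
        using card_T_le[of n] alpha e by (intro mult_right_mono) auto
      also have "\<dots> = \<alpha> * e" using elim by simp
      also have "\<dots> \<le> e" using alpha e mult_right_mono[of \<alpha> 1 e] by simp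
      finally show ?thesis .
    qed
    moreover have "m.prob ?B \<le> H s + m.prob (space (M n) - G n)"
      unfolding m.prob_S_le[symmetric] by (intro measure_Un_le) auto
    moreover have "y = H s + 2 * e" by (simp add: e_def field_simps)
    ultimately show ?case using elim by linarith
  qed
qed

end

theorem theorem4p2:
  fixes \<alpha> \<nu> t2 :: real
    and M :: "nat \<Rightarrow> 'a measure"
    and T :: "nat \<Rightarrow> nat set"
    and X :: "nat \<Rightarrow> nat \<Rightarrow> 'a \<Rightarrow> real"
    and S :: "nat \<Rightarrow> 'a \<Rightarrow> real"
  assumes alpha: "0 < \<alpha>" "\<alpha> \<le> 1 / 2"
    and nu: "0 < \<nu>"
    and prob: "\<And>n. prob_space (M n)"
    and T_sub: "\<And>n. T n \<subseteq> {..<n}"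
    and zeta: "(\<lambda>n. real (card (T n)) / real n) \<longlonglongrightarrow> 1"
    and X_distr: "\<And>n i. i \<in> T n \<Longrightarrow>
        distributed (M n) lborel (X n i) (\<lambda>x. ennreal (std_normal_density x))"
    and S_pos: "\<And>n \<omega>. \<omega> \<in> space (M n) \<Longrightarrow> 0 < S n \<omega>"
    and S_distr: "\<And>n. distributed (M n) lborel (\<lambda>\<omega>. \<nu> * (S n \<omega>)\<^sup>2)
        (\<lambda>x. ennreal (chisq_density \<nu> x))"
    and indep: "\<And>n. prob_space.indep_vars (M n) (\<lambda>_. borel)
        (\<lambda>j. case j of None \<Rightarrow> S n | Some i \<Rightarrow> X n i) (insert None (Some ` T n))"
    and tangent: "is_tangent_point \<nu> \<alpha> t2"
  shows "LCP_set \<nu> \<alpha> = {0} \<union> {t2<..<\<alpha> / 2}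
    \<and> (\<lambda>n. (\<integral>\<omega>. real (V_count \<nu> \<alpha> n (T n) (X n) (S n) \<omega>) / real n \<partial>M n))
        \<longlonglongrightarrow> t2 * F_chi \<nu> (sqrt \<nu> * s_cross \<nu> \<alpha> t2) / \<alpha>
            + integral {t2 / \<alpha>..1} (\<lambda>t. F_chi \<nu> (sqrt \<nu> * s_cross \<nu> \<alpha> (\<alpha> * t)))
    \<and> (\<lambda>n. (\<integral>\<omega>. real (V_count \<nu> \<alpha> n (T n) (X n) (S n) \<omega>)
               / real (max (R_count \<nu> \<alpha> n (T n) (X n) (S n) \<omega>) 1) \<partial>M n))
        \<longlonglongrightarrow> F_chi \<nu> (sqrt \<nu> * s_cross \<nu> \<alpha> t2)"
proof -
  interpret tangent_point \<alpha> \<nu> t2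
    using alpha nu tangent by unfold_locales
  interpret t_model_seq \<alpha> \<nu> t2 M T X S
  proof (intro t_model_seq.intro t_model_seq_axioms.intro)
    show "tangent_point \<alpha> \<nu> t2" by (rule tangent_point_axioms)
    show "t_model \<alpha> \<nu> t2 (M n) n (T n) (X n) (S n)" for n
      by (intro t_model.intro t_model_axioms.intro tangent_point_axioms)
        (use prob T_sub X_distr S_pos S_distr indep in auto)
  qed (rule zeta)
  show ?thesis
    using LCP_set_eq EER_tendsto FDR_tendsto unfolding s2_def by blast
qed

end
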